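(* For every integer $t \geq 1$ there exists a graph $G_t$ such that $\chi_{DPP}(G_t) - \chi_{DP}(G_t) \geq t$ and, additionally, $\chi_{P}(G_t) - \chi_{DP}(G_t) \geq t$.
   Context: Graphs are finite and simple. **DP-coloring.** Given a graph $G$ and a function $f:V(G)\to\mathbb N$, an $f$-fold cover of $G$ is a graph $H$ obtained as follows: for each $v\in V(G)$, add to $H$ a clique on $f(v)$ new vertices, with vertex set denoted $L(v)$ (the sets $L(v)$ are pairwise disjoint); for each edge $uv\in E(G)$, add an arbitrary (possibly empty, not necessarily perfect) matching between $L(u)$ and $L(v)$; there are no other edges. A DP-coloring of $G$ with respect to $H$ is an independent set of $H$ of size $|V(G)|$ (equivalently, an independent set containing exactly one element of each $L(v)$). $G$ is DP-$f$-colorable if it has a DP-coloring with respect to every $f$-fold cover. The DP-chromatic number $\chi_{DP}(G)$ is the least integer $k$ such that $G$ is DP-$f$-colorable for the constant function $f=k$. **Online DP-coloring.** The DP-coloring game is played by Lister and Painter on a graph $G$ in which each vertex $v$ initially has $f(v)$ tokens. On each turn $i$, Lister removes some number $m_i(v)\ge 0$ of the remaining tokens from each vertex $v$ (at least one token being removed in total, so that the game is finite) and reveals a clique on $m_i(v)$ new vertices (colors) above each $v$ and, for each edge $uv\in E(G)$, a matching between the cliques just revealed above $u$ and $v$; these cliques and matchings form a cover $H_i$ of $G$. Painter then chooses an independent set of $H_i$. The game ends when no tokens remain. Painter wins if she has chosen at least one color above every vertex of $G$ before the game is over; otherwise Lister wins. The online DP-chromatic number $\chi_{DPP}(G)$ is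 the least integer $k$ such that Painter has a winning strategy when every vertex starts with $k$ tokens. **Online list coloring.** The list-coloring game is played by Lister and Painter on a graph $G$ in which each vertex $v$ initially has $f(v)$ tokens. On each turn $i$, Lister chooses a (nonempty) induced subgraph $G_i'$ of $G$ all of whose vertices have at least one remaining token, reveals a color $c_i$ (a new color on each turn) above each vertex of $G_i'$, and one token is removed from each vertex of $G_i'$. Painter then chooses an independent set $I_i$ of $G_i'$ and colors each vertex of $I_i$ with $c_i$. The game ends when no tokens remain. Painter wins if and only if every vertex of $G$ is colored before the game ends. $G$ is $f$-paintable if Painter has a winning strategy, and $\chi_P(G)$ is the least integer $k$ such that $G$ is $f$-paintable for the constant function $f=k$. *)

theory Defs
  imports "HOL-Library.Disjoint_Sets"
begin

record 'a graph =
  verts :: "'a set"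
  edges :: "'a set set"

definition simple_graph :: "'a graph \<Rightarrow> bool" where
  "simple_graph G \<longleftrightarrow> finite (verts G) \<and> (\<forall>e\<in>edges G. e \<subseteq> verts G \<and> card e = 2)"

definition independent_in :: "'a graph \<Rightarrow> 'a set \<Rightarrow> bool" where
  "independent_in G I \<longleftrightarrow> I \<subseteq> verts G \<and> (\<forall>x\<in>I. \<forall>y\<in>I. {x, y} \<notin> edges G)"

definition clique_in :: "'a graph \<Rightarrow> 'a set \<Rightarrow> bool" where
  "clique_in G K \<longleftrightarrow> K \<subseteq> verts G \<and> (\<forall>x\<in>K. \<forall>y\<in>K. x \<noteq> y \<longrightarrow> {x, y} \<in> edges G)"

definition induced_subgraph :: "'a graph \<Rightarrow> 'a set \<Rightarrow> 'a graph" where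
  "induced_subgraph G S = \<lparr>verts = S, edges = {e \<in> edges G. e \<subseteq> S}\<rparr>"

definition edges_between :: "'a graph \<Rightarrow> 'a set \<Rightarrow> 'a set \<Rightarrow> 'a set set" where
  "edges_between G A B = {e \<in> edges G. \<exists>x\<in>A. \<exists>y\<in>B. e = {x, y}}"

definition matching :: "'a set set \<Rightarrow> bool" where
  "matching M \<longleftrightarrow> pairwise disjnt M"


section \<open>DP-coloring\<close>

definition fold_cover :: "'a graph \<Rightarrow> ('a \<Rightarrow> nat) \<Rightarrow> ('a \<Rightarrow> 'c set) \<Rightarrow> 'c graph \<Rightarrow> bool" where
  "fold_cover G f L H \<longleftrightarrow>
     simple_graph H \<and>
     verts H = (\<Union>v\<in>verts G. L v) \<and>
     disjoint_family_on L (verts G) \<and>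
     (\<forall>v\<in>verts G. card (L v) = f v \<and> clique_in H (L v)) \<and>
     (\<forall>u\<in>verts G. \<forall>v\<in>verts G. {u, v} \<in> edges G \<longrightarrow> matching (edges_between H (L u) (L v))) \<and>
     (\<forall>u\<in>verts G. \<forall>v\<in>verts G. u \<noteq> v \<and> {u, v} \<notin> edges G \<longrightarrow> edges_between H (L u) (L v) = {})"

text \<open>A cover of a finite graph is finite, so up to renaming its vertices are natural numbers.\<close>

definition DP_colorable :: "'a graph \<Rightarrow> ('a \<Rightarrow> nat) \<Rightarrow> bool" where
  "DP_colorable G f \<longleftrightarrow>
     (\<forall>(L :: 'a \<Rightarrow> nat set) H. fold_cover G f L H \<longrightarrow>
        (\<exists>I. independent_in H I \<and> card I = card (verts G)))"

definition chi_DP :: "'a graph \<Rightarrow> nat" where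
  "chi_DP G = (LEAST k. DP_colorable G (\<lambda>_. k))"


section \<open>Plays and strategies\<close>

text \<open>A play is the list of turns, each consisting of Lister's move and Painter's answer.
  A strategy for Painter yields the answer from the earlier turns and Lister's current move.\<close>

type_synonym ('m, 'r) play = "('m \<times> 'r) list"
type_synonym ('m, 'r) strategy = "('m, 'r) play \<Rightarrow> 'm \<Rightarrow> 'r"

definition follows :: "('m, 'r) strategy \<Rightarrow> ('m, 'r) play \<Rightarrow> bool" where
  "follows \<sigma> p \<longleftrightarrow> (\<forall>i<length p. snd (p ! i) = \<sigma> (take i p) (fst (p ! i)))"


section \<open>Online DP-coloring\<close>

text \<open>Lister's move is a pair \<open>(L, H)\<close>, where the number of tokens removed from \<open>v\<close>
  is \<open>card (L v)\<close>.\<close>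

type_synonym 'a dp_move = "('a \<Rightarrow> nat set) \<times> nat graph"
type_synonym 'a dp_play = "('a dp_move, nat set) play"

definition dp_removed :: "'a dp_play \<Rightarrow> 'a \<Rightarrow> nat" where
  "dp_removed p v = (\<Sum>((L, H), I)\<leftarrow>p. card (L v))"

definition dp_lister_legal :: "'a graph \<Rightarrow> ('a \<Rightarrow> nat) \<Rightarrow> 'a dp_play \<Rightarrow> bool" where
  "dp_lister_legal G f p \<longleftrightarrow>
     (\<forall>i<length p. \<forall>L H I. p ! i = ((L, H), I) \<longrightarrow>
        fold_cover G (\<lambda>v. card (L v)) L H \<and>
        (\<forall>v\<in>verts G. card (L v) \<le> f v - dp_removed (take i p) v) \<and>
        (\<exists>v\<in>verts G. card (L v) > 0) \<and>
        (\<forall>j<i. \<forall>L' H' I'. p ! j = ((L', H'), I') \<longrightarrow> verts H \<inter> verts H' = {}))"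

definition dp_game_over :: "'a graph \<Rightarrow> ('a \<Rightarrow> nat) \<Rightarrow> 'a dp_play \<Rightarrow> bool" where
  "dp_game_over G f p \<longleftrightarrow> (\<forall>v\<in>verts G. f v - dp_removed p v = 0)"

definition dp_painter_legal :: "'a dp_play \<Rightarrow> bool" where
  "dp_painter_legal p \<longleftrightarrow> (\<forall>((L, H), I)\<in>set p. independent_in H I)"

definition dp_painter_wins :: "'a graph \<Rightarrow> 'a dp_play \<Rightarrow> bool" where
  "dp_painter_wins G p \<longleftrightarrow> (\<forall>v\<in>verts G. \<exists>((L, H), I)\<in>set p. I \<inter> L v \<noteq> {})"

definition DP_paintable :: "'a graph \<Rightarrow> ('a \<Rightarrow> nat) \<Rightarrow> bool" where
  "DP_paintable G f \<longleftrightarrow>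
     (\<exists>\<sigma> :: ('a dp_move, nat set) strategy. \<forall>p.
        follows \<sigma> p \<and> dp_lister_legal G f p \<and> dp_game_over G f p \<longrightarrow>
        dp_painter_legal p \<and> dp_painter_wins G p)"

definition chi_DPP :: "'a graph \<Rightarrow> nat" where
  "chi_DPP G = (LEAST k. DP_paintable G (\<lambda>_. k))"


section \<open>Online list coloring\<close>

text \<open>Lister's move is the vertex set \<open>S\<close> of the induced subgraph. The color of a turn is new,
  so it is identified with the position of the turn in the play.\<close>

type_synonym 'a list_play = "('a set, 'a set) play"

definition list_removed :: "'a list_play \<Rightarrow> 'a \<Rightarrow> nat" where
  "list_removed p v = (\<Sum>(S, I)\<leftarrow>p. if v \<in> S then 1 else 0)"

definition list_lister_legal :: "'a graph \<Rightarrow> ('a \<Rightarrow> nat) \<Rightarrow> 'a list_play \<Rightarrow> bool" where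
  "list_lister_legal G f p \<longleftrightarrow>
     (\<forall>i<length p. \<forall>S I. p ! i = (S, I) \<longrightarrow>
        S \<noteq> {} \<and> S \<subseteq> verts G \<and> (\<forall>v\<in>S. f v - list_removed (take i p) v \<ge> 1))"

definition list_game_over :: "'a graph \<Rightarrow> ('a \<Rightarrow> nat) \<Rightarrow> 'a list_play \<Rightarrow> bool" where
  "list_game_over G f p \<longleftrightarrow> (\<forall>v\<in>verts G. f v - list_removed p v = 0)"

definition list_painter_legal :: "'a graph \<Rightarrow> 'a list_play \<Rightarrow> bool" where
  "list_painter_legal G p \<longleftrightarrow> (\<forall>(S, I)\<in>set p. independent_in (induced_subgraph G S) I)"

definition list_painter_wins :: "'a graph \<Rightarrow> 'a list_play \<Rightarrow> bool" where
  "list_painter_wins G p \<longleftrightarrow> (\<forall>v\<in>verts G. \<exists>(S, I)\<in>set p. v \<in> I)"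

definition paintable :: "'a graph \<Rightarrow> ('a \<Rightarrow> nat) \<Rightarrow> bool" where
  "paintable G f \<longleftrightarrow>
     (\<exists>\<sigma> :: ('a set, 'a set) strategy. \<forall>p.
        follows \<sigma> p \<and> list_lister_legal G f p \<and> list_game_over G f p \<longrightarrow>
        list_painter_legal G p \<and> list_painter_wins G p)"

definition chi_P :: "'a graph \<Rightarrow> nat" where
  "chi_P G = (LEAST k. paintable G (\<lambda>_. k))"

end

theory Submission
  imports Defs "HOL-Library.Nat_Bijection" "HOL-Library.FuncSet"
begin

text \<open>Online, Lister can run many cliques down to one uncolored vertex each, where Painter decides which
one it is, and then attack exactly these vertices through their neighbors; a cover that is fixed
in advance cannot react in this way.

The graph has parameters \<open>t\<close> (the gap) and \<open>z\<close> (large). A gadget clique has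
\<open>t + 1\<close> vertices; its \<open>i\<close>-th vertex is joined to \<open>t\<close> vertices, the \<open>i\<close>-th group of hubs. Very many
gadget cliques share the same \<open>t + 1\<close> groups of hubs, which are pairwise nonadjacent, and together with
them they form one copy. The graph consists of a huge number of disjoint copies and of \<open>z\<close> common
vertices, each joined to the clique vertices of all copies.

Lister wins with \<open>z + 2 * t\<close> tokens per vertex. A vertex with \<open>F\<close> tokens that is adjacent to
everything in \<open>F * N\<close> disjoint blocks can be presented with \<open>N\<close> blocks at a time: before its tokens run
out Painter must color it, and then \<open>N\<close> blocks have lost a token without any gain
(\<open>burn_vertices\<close>). Applied to the common vertices, this leaves a copy whose clique vertices all have
\<open>2 * t\<close> tokens. Presenting all cliques of that copy \<open>t\<close> times leaves in each clique an uncolored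
vertex with \<open>t\<close> tokens (\<open>play_cliques\<close>). By pigeonhole many of these survivors have the same
index \<open>i\<close>, and the \<open>i\<close>-th group of hubs burns their last \<open>t\<close> tokens (\<open>lister_wins_gap_graph\<close>).

A DP-coloring exists already with \<open>z + t + 1\<close> colors per vertex (\<open>DP_colorable_gap_graph\<close>). However the
common vertices are colored, every clique vertex keeps \<open>t + 1\<close> colors. A clique of \<open>t + 1\<close>
vertices with \<open>t + 1\<close> colors each fails only if the hubs block at least \<open>t + 1\<close> of
these colors in total (\<open>small_deficit_transversal\<close>). A random color of a hub blocks anything in a given clique with
probability at most \<open>(t + 1) / z\<close>, so a clique fails with probability of order \<open>1 / z ^ (t + 1)\<close>, while a copy
has only about \<open>z ^ t\<close> cliques; hence some coloring of the hubs spoils no clique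
(\<open>choice_with_few_hits\<close>).

The online DP-coloring game is at least as hard for Painter as the list-coloring game
(\<open>DP_paintable_imp_paintable\<close>), so the same graph serves for both parameters. Since these are defined
as least numbers, it also matters that Painter wins with some constant number of tokens
(\<open>DP_paintable_card_verts\<close>).\<close>

section \<open>Lister's winning positions in the list-coloring game\<close>

text \<open>Strategies are replaced by positions: \<open>f\<close> gives the remaining tokens and \<open>U\<close> the uncolored
vertices. Lister never needs to present a colored vertex, so \<open>S \<subseteq> U\<close>. A set \<open>S\<close> that is empty or
contains a vertex without tokens is no legal move, but it does no harm: the former changes
nothing, and in the latter case Lister has already won.\<close>

inductive lister_wins :: "'a graph \<Rightarrow> ('a \<Rightarrow> nat) \<Rightarrow> 'a set \<Rightarrow> bool" for G where
  dead: "\<lbrakk>v \<in> U; f v = 0\<rbrakk> \<Longrightarrow> lister_wins G f U"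
| turn: "\<lbrakk>S \<subseteq> U;
          \<And>I. independent_in (induced_subgraph G S) I \<Longrightarrow>
                lister_wins G (\<lambda>v. f v - (if v \<in> S then 1 else 0)) (U - I)\<rbrakk>
         \<Longrightarrow> lister_wins G f U"

text \<open>Fewer tokens and more uncolored vertices can only help Lister. This permits to forget all parts of a
position that a strategy does not use, and it passes from one number of tokens to all smaller
ones.\<close>

lemma lister_wins_mono:
  "lister_wins G f U \<Longrightarrow> (\<And>v. g v \<le> f v) \<Longrightarrow> U \<subseteq> U' \<Longrightarrow> lister_wins G g U'"
proof (induction arbitrary: g U' rule: lister_wins.induct)
  case (dead v U f)
  have "g v = 0" using dead.hyps(2) dead.prems(1)[of v] by simp
  then show ?case using dead.hyps(1) dead.prems(2) by (auto intro: lister_wins.dead)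
next
  case (turn S U f)
  show ?case
  proof (rule lister_wins.turn)
    show "S \<subseteq> U'" using turn.hyps turn.prems(2) by blast
    fix I assume "independent_in (induced_subgraph G S) I"
    then show "lister_wins G (\<lambda>v. g v - (if v \<in> S then 1 else 0)) (U' - I)"
      by (rule turn.IH) (use turn.prems in \<open>auto intro: diff_le_mono\<close>)
  qed
qed

lemma independent_in_induced_subset:
  "independent_in (induced_subgraph G S) I \<Longrightarrow> I \<subseteq> S"
  by (simp add: independent_in_def induced_subgraph_def)

lemma follows_Nil [simp]: "follows \<sigma> []"
  by (simp add: follows_def)

lemma follows_snoc [simp]:
  "follows \<sigma> (p @ [x]) \<longleftrightarrow> follows \<sigma> p \<and> snd x = \<sigma> p (fst x)"
  by (auto simp: follows_def nth_append less_Suc_eq)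

lemma list_removed_append [simp]:
  "list_removed (p @ q) v = list_removed p v + list_removed q v"
  by (simp add: list_removed_def)

lemma list_removed_Nil [simp]: "list_removed [] v = 0"
  by (simp add: list_removed_def)

lemma list_removed_single [simp]: "list_removed [(S, I)] v = (if v \<in> S then 1 else 0)"
  by (simp add: list_removed_def)

lemma list_lister_legal_Nil [simp]: "list_lister_legal G f []"
  by (simp add: list_lister_legal_def)

lemma list_lister_legal_snoc [simp]:
  "list_lister_legal G f (p @ [(S, I)]) \<longleftrightarrow>
     list_lister_legal G f p \<and> S \<noteq> {} \<and> S \<subseteq> verts G \<and> (\<forall>v\<in>S. list_removed p v < f v)"
proof -
  have *: "f v - n \<ge> 1 \<longleftrightarrow> n < f v" for v n
    by auto
  show ?thesis
    unfolding list_lister_legal_def * by (simp add: nth_append less_Suc_eq imp_conjR all_conj_distrib) blast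
qed

text \<open>A play is judged only when no tokens remain, so a play in which Painter is already lost
still has to be finished; single vertices do.\<close>

lemma complete_list_play:
  assumes "finite (verts G)" "follows \<sigma> p" "list_lister_legal G f p"
  shows "\<exists>q. follows \<sigma> (p @ q) \<and> list_lister_legal G f (p @ q) \<and> list_game_over G f (p @ q)"
  using assms(2,3)
proof (induction "\<Sum>v\<in>verts G. f v - list_removed p v" arbitrary: p rule: less_induct)
  case less
  show ?case
  proof (cases "list_game_over G f p")
    case True
    with less.prems show ?thesis by (intro exI[of _ "[]"]) simp
  next
    case False
    then obtain v where v: "v \<in> verts G" "list_removed p v < f v"
      by (auto simp: list_game_over_def)
    define p' where "p' = p @ [({v}, \<sigma> p {v})]"
    have "(\<Sum>w\<in>verts G. f w - list_removed p' w) < (\<Sum>w\<in>verts G. f w - list_removed p w)"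
      unfolding p'_def using v assms(1)
      by (intro sum_strict_mono_ex1) (auto intro!: bexI[of _ v])
    moreover have "follows \<sigma> p'" "list_lister_legal G f p'"
      using less.prems v by (auto simp: p'_def)
    ultimately obtain q where "follows \<sigma> (p' @ q) \<and> list_lister_legal G f (p' @ q) \<and>
        list_game_over G f (p' @ q)"
      using less.hyps by blast
    then show ?thesis by (auto simp: p'_def)
  qed
qed

lemma list_lister_legal_later:
  assumes "list_lister_legal G f (p @ q)" "(S, I) \<in> set q" "v \<in> S"
  shows "list_removed p v < f v"
proof -
  obtain i where i: "i < length q" "q ! i = (S, I)"
    using assms(2) by (auto simp: in_set_conv_nth)
  have "(p @ q) ! (length p + i) = (S, I)" "length p + i < length (p @ q)"
    using i by simp_all
  then have "list_removed (take (length p + i) (p @ q)) v < f v"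
    using assms(1,3) unfolding list_lister_legal_def by fastforce
  then show ?thesis by simp
qed

lemma dead_vertex_refutes:
  assumes G: "finite (verts G)"
    and win: "\<And>p. follows \<sigma> p \<Longrightarrow> list_lister_legal G f p \<Longrightarrow> list_game_over G f p \<Longrightarrow>
        list_painter_legal G p \<and> list_painter_wins G p"
    and p: "follows \<sigma> p" "list_lister_legal G f p"
    and v: "v \<in> verts G" "f v \<le> list_removed p v" "\<forall>(S, I)\<in>set p. v \<notin> I"
  shows False
proof -
  obtain q where q: "follows \<sigma> (p @ q)" "list_lister_legal G f (p @ q)" "list_game_over G f (p @ q)"
    using complete_list_play[OF G p] by blast
  have w: "list_painter_legal G (p @ q)" "list_painter_wins G (p @ q)"
    using win[OF q] by auto
  obtain S I where SI: "(S, I) \<in> set (p @ q)" "v \<in> I"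
    using w(2) v(1) by (fastforce simp: list_painter_wins_def)
  then have "(S, I) \<in> set q" using v(3) by auto
  moreover have "v \<in> S"
    using w(1) SI independent_in_induced_subset unfolding list_painter_legal_def by fastforce
  ultimately show False
    using list_lister_legal_later[OF q(2)] v(2) by fastforce
qed

text \<open>A winning strategy of Painter is followed along the derivation of \<open>lister_wins\<close>, one turn of the
play per inference, until an uncolored vertex has no tokens.\<close>

lemma lister_wins_refutes:
  assumes G: "finite (verts G)"
    and win: "\<And>p. follows \<sigma> p \<Longrightarrow> list_lister_legal G f p \<Longrightarrow> list_game_over G f p \<Longrightarrow>
        list_painter_legal G p \<and> list_painter_wins G p"
  shows "lister_wins G g U \<Longrightarrow> follows \<sigma> p \<Longrightarrow> list_lister_legal G f p \<Longrightarrow> U \<subseteq> verts G \<Longrightarrow>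
     (\<And>v. f v - list_removed p v \<le> g v) \<Longrightarrow> (\<And>v. v \<in> U \<Longrightarrow> \<forall>(S, I)\<in>set p. v \<notin> I) \<Longrightarrow> False"
proof (induction arbitrary: p rule: lister_wins.induct)
  case (dead v U g)
  show ?case
    by (rule dead_vertex_refutes[OF G win, where p = p and v = v]) (use dead.hyps dead.prems(4)[of v] dead.prems in auto)
next
  case (turn S U g)
  show ?case
  proof (cases "S = {} \<or> (\<exists>v\<in>S. f v \<le> list_removed p v)")
    case True
    then show ?thesis
    proof
      assume S: "S = {}"
      have "independent_in (induced_subgraph G S) {}"
        by (simp add: independent_in_def)
      then show False
      proof (rule turn.IH[OF _ turn.prems(1,2)])
        show "f v - list_removed p v \<le> g v - (if v \<in> S then 1 else 0)" for v
          using turn.prems(4)[of v] S by simp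
      qed (use turn.prems(3,5) in auto)
    next
      assume "\<exists>v\<in>S. f v \<le> list_removed p v"
      then obtain v where "v \<in> S" "f v \<le> list_removed p v" ..
      then show False
        using dead_vertex_refutes[OF G win turn.prems(1,2), of v] turn.hyps(1) turn.prems(3,5) by blast
    qed
  next
    case False
    define I where "I = \<sigma> p S"
    have p': "follows \<sigma> (p @ [(S, I)])" "list_lister_legal G f (p @ [(S, I)])"
      using turn.prems turn.hyps False by (auto simp: I_def not_le)
    \<comment> \<open>Painter's answer is legal, because a completion of this play would be judged.\<close>
    obtain q where "follows \<sigma> ((p @ [(S, I)]) @ q)" "list_lister_legal G f ((p @ [(S, I)]) @ q)"
        "list_game_over G f ((p @ [(S, I)]) @ q)"
      using complete_list_play[OF G p'] by blast
    then have "list_painter_legal G ((p @ [(S, I)]) @ q)" using win by blast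
    then have I: "independent_in (induced_subgraph G S) I"
      by (auto simp: list_painter_legal_def)
    show ?thesis
    proof (rule turn.IH[OF I p'])
      show "U - I \<subseteq> verts G" using turn.prems(3) by blast
      show "f v - list_removed (p @ [(S, I)]) v \<le> g v - (if v \<in> S then 1 else 0)" for v
        using turn.prems(4)[of v] by auto
      show "\<forall>(S', I')\<in>set (p @ [(S, I)]). v \<notin> I'" if "v \<in> U - I" for v
        using turn.prems(5)[of v] that by auto
    qed
  qed
qed

lemma lister_wins_not_paintable:
  assumes "finite (verts G)" "lister_wins G f (verts G)"
  shows "\<not> paintable G f"
proof
  assume "paintable G f"
  then obtain \<sigma> where \<sigma>: "\<And>p. follows \<sigma> p \<Longrightarrow> list_lister_legal G f p \<Longrightarrow> list_game_over G f p \<Longrightarrow>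
        list_painter_legal G p \<and> list_painter_wins G p"
    unfolding paintable_def by blast
  show False
  proof (rule lister_wins_refutes[OF assms(1) _ assms(2)])
    show "f v - list_removed [] v \<le> f v" for v by simp
    show "follows \<sigma> []" "list_lister_legal G f []" by simp_all
  qed (use \<sigma> in auto)
qed

section \<open>Burning tokens\<close>

text \<open>Lister presents \<open>x\<close> together with \<open>N\<close> of the blocks. If Painter colors \<open>x\<close>, nothing in these blocks can be
colored, and they have lost a token. Otherwise \<open>x\<close> has lost a token at the price of \<open>N\<close>
blocks, which are given up. This cannot happen \<open>f x\<close> times, and there are enough blocks.\<close>

lemma burn_vertex:
  assumes adj: "\<And>j v. j \<in> J \<Longrightarrow> v \<in> B j \<Longrightarrow> {x, v} \<in> edges G"
    and "x \<in> U" "disjoint_family_on B J" "\<And>j. j \<in> J \<Longrightarrow> B j \<subseteq> U - {x}" "f x * N \<le> card J"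
    and "\<And>J'. J' \<subseteq> J \<Longrightarrow> N \<le> card J' \<Longrightarrow>
      lister_wins G (\<lambda>v. f v - (if v \<in> \<Union>(B ` J') then 1 else 0)) (U - {x} - \<Union>(B ` (J - J')))"
  shows "lister_wins G f U"
  using assms
proof (induction "f x" arbitrary: f U J)
  case 0
  then show ?case by (auto intro: lister_wins.dead)
next
  case (Suc a)
  obtain J1 where J1: "J1 \<subseteq> J" "card J1 = N" "finite J1"
    using Suc.prems(5) Suc.hyps(2)
    by (metis add_leD1 mult_Suc obtain_subset_with_card_n)
  define S where "S = insert x (\<Union>(B ` J1))"
  define f' where "f' = (\<lambda>v. f v - (if v \<in> S then 1 else 0))"
  have S: "S \<subseteq> U" using Suc.prems(2,4) J1 by (auto simp: S_def)
  show ?case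
  proof (rule lister_wins.turn[OF S])
    fix I assume I: "independent_in (induced_subgraph G S) I"
    then have IS: "I \<subseteq> S" by (rule independent_in_induced_subset)
    have "lister_wins G f' (U - I)"
    proof (cases "x \<in> I")
      case True
      have "v \<notin> I" if "j \<in> J1" "v \<in> B j" for j v
      proof
        assume "v \<in> I"
        then have "{x, v} \<notin> edges (induced_subgraph G S)"
          using I True by (auto simp: independent_in_def)
        moreover have "{x, v} \<in> edges G" using Suc.prems(1) that J1 by blast
        ultimately show False using that by (auto simp: induced_subgraph_def S_def)
      qed
      with IS True have "I = {x}" by (auto simp: S_def)
      show ?thesis
        by (rule lister_wins_mono[OF Suc.prems(6)[OF J1(1)]])
          (use J1 \<open>I = {x}\<close> in \<open>auto simp: f'_def S_def\<close>)
    next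
      case False
      define U2 where "U2 = U - \<Union>(B ` J1)"
      have disj: "B i \<inter> B j = {}" if "i \<in> J1" "j \<in> J - J1" for i j
        using Suc.prems(3) J1(1) that unfolding disjoint_family_on_def by (metis Diff_iff subsetD)
      have "lister_wins G f' U2"
      proof (rule Suc.hyps(1)[where J = "J - J1"])
        show "a = f' x" using Suc.hyps(2) by (simp add: f'_def S_def)
        show "\<And>j v. j \<in> J - J1 \<Longrightarrow> v \<in> B j \<Longrightarrow> {x, v} \<in> edges G"
          using Suc.prems(1) by blast
        show "x \<in> U2" using Suc.prems(2,4) J1 by (auto simp: U2_def)
        show "disjoint_family_on B (J - J1)"
          using Suc.prems(3) by (auto simp: disjoint_family_on_def)
        show "\<And>j. j \<in> J - J1 \<Longrightarrow> B j \<subseteq> U2 - {x}"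
          using Suc.prems(4) disj by (fastforce simp: U2_def)
        show "f' x * N \<le> card (J - J1)"
        proof -
          have "f' x = a" using Suc.hyps(2) by (simp add: f'_def S_def)
          moreover have "N + a * N \<le> card J" using Suc.prems(5) by (simp flip: Suc.hyps(2))
          ultimately show ?thesis using J1 by (simp add: card_Diff_subset)
        qed
        fix J' assume J': "J' \<subseteq> J - J1" "N \<le> card J'"
        show "lister_wins G (\<lambda>v. f' v - (if v \<in> \<Union>(B ` J') then 1 else 0))
            (U2 - {x} - \<Union>(B ` (J - J1 - J')))"
        proof (rule lister_wins_mono[OF Suc.prems(6)[of J']])
          show "U - {x} - \<Union>(B ` (J - J')) \<subseteq> U2 - {x} - \<Union>(B ` (J - J1 - J'))"
            using J' J1(1) unfolding U2_def by blast
        qed (use J' in \<open>auto simp: f'_def\<close>)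
      qed
      moreover have "U2 \<subseteq> U - I" using IS False by (auto simp: U2_def S_def)
      ultimately show ?thesis using lister_wins_mono by blast
    qed
    then show "lister_wins G (\<lambda>v. f v - (if v \<in> S then 1 else 0)) (U - I)"
      by (simp add: f'_def)
  qed
qed

text \<open>The blocks that survive the attack of one vertex are attacked by the next one, so each further
vertex costs a factor \<open>F\<close> in the number of blocks.\<close>

lemma burn_vertices:
  assumes "finite X"
    and "\<And>x j v. x \<in> X \<Longrightarrow> j \<in> J \<Longrightarrow> v \<in> B j \<Longrightarrow> {x, v} \<in> edges G"
    and "X \<subseteq> U" "disjoint_family_on B J" "\<And>j. j \<in> J \<Longrightarrow> B j \<subseteq> U - X"
    and "\<And>x. x \<in> X \<Longrightarrow> f x \<le> F" "F ^ card X * N \<le> card J"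
    and "\<And>J'. J' \<subseteq> J \<Longrightarrow> N \<le> card J' \<Longrightarrow>
      lister_wins G (\<lambda>v. f v - (if v \<in> \<Union>(B ` J') then card X else 0)) (U - X - \<Union>(B ` (J - J')))"
  shows "lister_wins G f U"
  using assms
proof (induction X arbitrary: f U J rule: finite_induct)
  case empty
  have "(\<lambda>v. f v - (if v \<in> \<Union>(B ` J) then card {} else 0)) = f" by auto
  with empty.prems(7)[of J] empty.prems(6) show ?case by (simp only: order_refl Diff_empty Diff_cancel image_empty Union_empty card.empty power_0 mult_1)
next
  case (insert x X)
  show ?case
  proof (rule burn_vertex[where x = x and J = J and B = B and N = "F ^ card X * N"])
    have "f x * (F ^ card X * N) \<le> F * (F ^ card X * N)"
      using insert.prems(5) by (intro mult_right_mono) auto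
    also have "F * (F ^ card X * N) = F ^ card (insert x X) * N"
      using insert.hyps by simp
    finally show "f x * (F ^ card X * N) \<le> card J"
      using insert.prems(6) by (rule order_trans)
    show "\<And>j v. j \<in> J \<Longrightarrow> v \<in> B j \<Longrightarrow> {x, v} \<in> edges G" using insert.prems(1) by blast
    show "\<And>j. j \<in> J \<Longrightarrow> B j \<subseteq> U - {x}" using insert.prems(4) by blast
    fix J1 assume J1: "J1 \<subseteq> J" "F ^ card X * N \<le> card J1"
    define f1 where "f1 = (\<lambda>v. f v - (if v \<in> \<Union>(B ` J1) then 1 else 0))"
    define U1 where "U1 = U - {x} - \<Union>(B ` (J - J1))"
    have disj: "B i \<inter> B j = {}" if "i \<in> J1" "j \<in> J - J1" for i j
      using insert.prems(3) J1(1) that unfolding disjoint_family_on_def by (metis Diff_iff subsetD)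
    have "lister_wins G f1 U1"
    proof (rule insert.IH[where J = J1])
      show "\<And>x j v. x \<in> X \<Longrightarrow> j \<in> J1 \<Longrightarrow> v \<in> B j \<Longrightarrow> {x, v} \<in> edges G"
        using insert.prems(1) J1 by blast
      show "X \<subseteq> U1" using insert.prems(2,4) insert.hyps unfolding U1_def by blast
      show "disjoint_family_on B J1"
        using insert.prems(3) J1 by (auto simp: disjoint_family_on_def)
      show "\<And>j. j \<in> J1 \<Longrightarrow> B j \<subseteq> U1 - X"
        using insert.prems(4) J1 disj unfolding U1_def by blast
      show "\<And>y. y \<in> X \<Longrightarrow> f1 y \<le> F"
        using insert.prems(5) by (auto simp: f1_def intro: order_trans[OF diff_le_self])
      show "F ^ card X * N \<le> card J1" by fact
      fix J' assume J': "J' \<subseteq> J1" "N \<le> card J'"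
      have card: "card (insert x X) = Suc (card X)" using insert.hyps by simp
      have *: "U - insert x X - \<Union>(B ` (J - J')) \<subseteq> U1 - X - \<Union>(B ` (J1 - J'))"
        using J' J1(1) unfolding U1_def by blast
      have le: "f1 v - (if v \<in> \<Union>(B ` J') then card X else 0)
          \<le> f v - (if v \<in> \<Union>(B ` J') then card (insert x X) else 0)" for v
      proof (cases "v \<in> \<Union>(B ` J')")
        case True
        then have "v \<in> \<Union>(B ` J1)" using J'(1) by blast
        with True show ?thesis by (simp add: f1_def card)
      qed (simp add: f1_def)
      have "lister_wins G (\<lambda>v. f v - (if v \<in> \<Union>(B ` J') then card (insert x X) else 0))
          (U - insert x X - \<Union>(B ` (J - J')))"
        using J' J1 by (intro insert.prems(7)) auto
      then show "lister_wins G (\<lambda>v. f1 v - (if v \<in> \<Union>(B ` J') then card X else 0))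
          (U1 - X - \<Union>(B ` (J1 - J')))"
        using le * by (rule lister_wins_mono)
    qed
    then show "lister_wins G (\<lambda>v. f v - (if v \<in> \<Union>(B ` J1) then 1 else 0))
        (U - {x} - \<Union>(B ` (J - J1)))"
      by (simp add: f1_def U1_def)
  qed (use insert.prems in auto)
qed

text \<open>All vertices of the cliques that are still uncolored are presented \<open>r\<close> times. Each time Painter colors at most
one vertex of each clique and the others lose a token. Which vertex \<open>u j\<close> remains is
Painter's choice.\<close>

lemma play_cliques:
  assumes "\<And>j x y. j \<in> J \<Longrightarrow> x \<in> K j \<Longrightarrow> y \<in> K j \<Longrightarrow> x \<noteq> y \<Longrightarrow> {x, y} \<in> edges G"
    and "\<And>j. j \<in> J \<Longrightarrow> K j \<subseteq> U" "\<And>j. j \<in> J \<Longrightarrow> r < card (K j)"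
    and "\<And>u. (\<And>j. j \<in> J \<Longrightarrow> u j \<in> K j) \<Longrightarrow>
      lister_wins G (\<lambda>v. f v - (if v \<in> u ` J then r else 0)) (U - \<Union>(K ` J) \<union> u ` J)"
  shows "lister_wins G f U"
  using assms
proof (induction r arbitrary: f U K)
  case 0
  have "\<exists>v. v \<in> K j" if "j \<in> J" for j using 0(3)[OF that] by (metis card.empty equals0I less_irrefl)
  then obtain u where u: "\<And>j. j \<in> J \<Longrightarrow> u j \<in> K j" by metis
  show ?case
    by (rule lister_wins_mono[OF 0(4)[OF u]]) (use 0(2) u in auto)
next
  case (Suc r)
  define S where "S = \<Union>(K ` J)"
  show ?case
  proof (rule lister_wins.turn[where S = S])
    show "S \<subseteq> U" using Suc.prems(2) by (auto simp: S_def)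
    fix I assume I: "independent_in (induced_subgraph G S) I"
    then have IS: "I \<subseteq> S" by (rule independent_in_induced_subset)
    have one: "x = y" if "j \<in> J" "x \<in> K j \<inter> I" "y \<in> K j \<inter> I" for j x y
    proof (rule ccontr)
      assume "x \<noteq> y"
      then have "{x, y} \<in> edges (induced_subgraph G S)"
        using Suc.prems(1) that by (auto simp: induced_subgraph_def S_def)
      then show False using I that by (auto simp: independent_in_def)
    qed
    show "lister_wins G (\<lambda>v. f v - (if v \<in> S then 1 else 0)) (U - I)"
    proof (rule Suc.IH[where K = "\<lambda>j. K j - I"])
      show "\<And>j x y. j \<in> J \<Longrightarrow> x \<in> K j - I \<Longrightarrow> y \<in> K j - I \<Longrightarrow> x \<noteq> y \<Longrightarrow> {x, y} \<in> edges G"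
        using Suc.prems(1) by blast
      show "\<And>j. j \<in> J \<Longrightarrow> K j - I \<subseteq> U - I" using Suc.prems(2) by blast
      show "r < card (K j - I)" if j: "j \<in> J" for j
      proof -
        have fin: "finite (K j)" using Suc.prems(3)[OF j] card.infinite by fastforce
        have "card (K j \<inter> I) \<le> 1"
          using one[OF j] fin by (intro card_le_Suc0_iff_eq[THEN iffD2, unfolded One_nat_def[symmetric]]) auto
        then show ?thesis
          using Suc.prems(3)[OF j] card_Int_Diff[OF fin, of I] by linarith
      qed
      fix u assume u: "\<And>j. j \<in> J \<Longrightarrow> u j \<in> K j - I"
      have "lister_wins G (\<lambda>v. f v - (if v \<in> u ` J then Suc r else 0)) (U - \<Union>(K ` J) \<union> u ` J)"
        using u by (intro Suc.prems(4)) blast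
      then show "lister_wins G (\<lambda>v. f v - (if v \<in> S then 1 else 0) - (if v \<in> u ` J then r else 0))
          (U - I - (\<Union>j\<in>J. K j - I) \<union> u ` J)"
        by (rule lister_wins_mono) (use u IS in \<open>auto simp: S_def\<close>)
    qed
  qed
qed

section \<open>Painting from online DP-coloring\<close>

text \<open>A turn of the list-coloring game becomes a turn of the DP-coloring game in which every presented vertex receives one
color and adjacent presented vertices receive adjacent colors. The number of the turn is part of the color, since
covers of different turns must be disjoint.\<close>

definition list_cover_lists :: "nat \<Rightarrow> nat set \<Rightarrow> nat \<Rightarrow> nat set" where
  "list_cover_lists i S v = (if v \<in> S then {prod_encode (i, v)} else {})"

definition list_cover :: "nat graph \<Rightarrow> nat \<Rightarrow> nat set \<Rightarrow> nat graph" where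
  "list_cover G i S = \<lparr>verts = (\<lambda>v. prod_encode (i, v)) ` S,
     edges = {{prod_encode (i, u), prod_encode (i, v)} | u v. u \<in> S \<and> v \<in> S \<and> {u, v} \<in> edges G}\<rparr>"

lemma simple_graph_edge_neq: "simple_graph G \<Longrightarrow> {u, v} \<in> edges G \<Longrightarrow> u \<noteq> v"
  by (force simp: simple_graph_def)

lemma card_list_cover_lists [simp]: "card (list_cover_lists i S v) = (if v \<in> S then 1 else 0)"
  by (simp add: list_cover_lists_def)

lemma prod_encode_edge_iff:
  "{prod_encode (i, u), prod_encode (i, v)} = {prod_encode (i, u'), prod_encode (i, v')}
    \<longleftrightarrow> {u, v} = {u', v'}"
  by (auto simp: doubleton_eq_iff)

lemma edges_list_cover_iff:
  "{prod_encode (i, u), prod_encode (i, v)} \<in> edges (list_cover G i S) \<longleftrightarrow>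
     u \<in> S \<and> v \<in> S \<and> {u, v} \<in> edges G"
  by (auto simp: list_cover_def prod_encode_edge_iff doubleton_eq_iff insert_commute)

lemma fold_cover_list_cover:
  assumes G: "simple_graph G" and S: "S \<subseteq> verts G"
  shows "fold_cover G (\<lambda>v. card (list_cover_lists i S v)) (list_cover_lists i S) (list_cover G i S)"
proof -
  have fin: "finite S" using G S finite_subset by (auto simp: simple_graph_def)
  have "simple_graph (list_cover G i S)"
    using fin simple_graph_edge_neq[OF G]
    by (fastforce simp: simple_graph_def list_cover_def card_2_iff doubleton_eq_iff)
  moreover have "verts (list_cover G i S) = (\<Union>v\<in>verts G. list_cover_lists i S v)"
    using S by (auto simp: list_cover_def list_cover_lists_def)
  moreover have "disjoint_family_on (list_cover_lists i S) (verts G)"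
    by (auto simp: disjoint_family_on_def list_cover_lists_def)
  moreover have "clique_in (list_cover G i S) (list_cover_lists i S v)" for v
    by (auto simp: clique_in_def list_cover_lists_def list_cover_def)
  moreover have "matching (edges_between (list_cover G i S) (list_cover_lists i S u) (list_cover_lists i S v))" for u v
    by (auto simp: matching_def pairwise_def edges_between_def list_cover_lists_def)
  moreover have "edges_between (list_cover G i S) (list_cover_lists i S u) (list_cover_lists i S v) = {}"
    if "{u, v} \<notin> edges G" for u v
    using that by (auto simp: edges_between_def list_cover_lists_def edges_list_cover_iff)
  ultimately show ?thesis
    by (auto simp: fold_cover_def)
qed

definition lift_move :: "nat graph \<Rightarrow> nat \<Rightarrow> nat set \<Rightarrow> nat dp_move" where
  "lift_move G i S = (list_cover_lists i S, list_cover G i S)"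

text \<open>The answers in the lifted play are those of \<open>\<sigma>\<close>, not the ones recorded in \<open>p\<close>. When
Painter obtains her answers from \<open>\<sigma>\<close> the two correspond.\<close>

definition lift_play :: "nat graph \<Rightarrow> (nat dp_move, nat set) strategy \<Rightarrow> nat list_play \<Rightarrow> nat dp_play" where
  "lift_play G \<sigma> p = foldl (\<lambda>q (S, I). q @ [(lift_move G (length q) S, \<sigma> q (lift_move G (length q) S))]) [] p"

lemma lift_play_Nil [simp]: "lift_play G \<sigma> [] = []"
  by (simp add: lift_play_def)

lemma length_lift_play [simp]: "length (lift_play G \<sigma> p) = length p"
  by (induction p rule: rev_induct) (auto simp: lift_play_def)

lemma lift_play_snoc [simp]:
  "lift_play G \<sigma> (p @ [(S, I)]) =
     lift_play G \<sigma> p @ [(lift_move G (length p) S, \<sigma> (lift_play G \<sigma> p) (lift_move G (length p) S))]"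
  using length_lift_play[of G \<sigma> p] by (simp add: lift_play_def)

lemma follows_lift_play: "follows \<sigma> (lift_play G \<sigma> p)"
  by (induction p rule: rev_induct) auto

lemma take_lift_play: "take i (lift_play G \<sigma> p) = lift_play G \<sigma> (take i p)"
  by (induction p rule: rev_induct) (auto simp: take_Cons')

lemma nth_lift_play:
  "i < length p \<Longrightarrow> lift_play G \<sigma> p ! i =
     (lift_move G i (fst (p ! i)), \<sigma> (lift_play G \<sigma> (take i p)) (lift_move G i (fst (p ! i))))"
  by (induction p rule: rev_induct) (auto simp: nth_append less_Suc_eq)

lemma dp_removed_lift_play [simp]: "dp_removed (lift_play G \<sigma> p) v = list_removed p v"
  by (induction p rule: rev_induct) (auto simp: dp_removed_def list_removed_def lift_move_def)

lemma DP_paintable_imp_paintable: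
  fixes G :: "nat graph"
  assumes G: "simple_graph G" and "DP_paintable G f"
  shows "paintable G f"
proof -
  from assms(2) obtain \<sigma> where \<sigma>: "\<And>p. follows \<sigma> p \<Longrightarrow> dp_lister_legal G f p \<Longrightarrow> dp_game_over G f p \<Longrightarrow>
        dp_painter_legal p \<and> dp_painter_wins G p"
    unfolding DP_paintable_def by blast
  define \<tau> where "\<tau> p S = {v \<in> S. prod_encode (length p, v) \<in>
      \<sigma> (lift_play G \<sigma> p) (lift_move G (length p) S)}" for p S
  have "list_painter_legal G p \<and> list_painter_wins G p"
    if p: "follows \<tau> p" "list_lister_legal G f p" "list_game_over G f p" for p
  proof -
    let ?q = "lift_play G \<sigma> p"
    have sub: "fst (p ! i) \<subseteq> verts G" if "i < length p" for i
      using p(2) that by (metis list_lister_legal_def prod.collapse)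
    have legal: "dp_lister_legal G f ?q"
      unfolding dp_lister_legal_def
    proof (intro allI impI)
      fix i L H I assume i: "i < length ?q" "?q ! i = ((L, H), I)"
      obtain S I' where SI: "p ! i = (S, I')" by fastforce
      have S: "S \<noteq> {}" "S \<subseteq> verts G" "\<forall>v\<in>S. f v - list_removed (take i p) v \<ge> 1"
        using p(2) i(1) SI by (auto simp: list_lister_legal_def)
      have LH: "L = list_cover_lists i S" "H = list_cover G i S"
        using i SI by (auto simp: nth_lift_play lift_move_def)
      show "fold_cover G (\<lambda>v. card (L v)) L H \<and>
          (\<forall>v\<in>verts G. card (L v) \<le> f v - dp_removed (take i ?q) v) \<and>
          (\<exists>v\<in>verts G. 0 < card (L v)) \<and>
          (\<forall>j<i. \<forall>L' H' I'. ?q ! j = ((L', H'), I') \<longrightarrow> verts H \<inter> verts H' = {})"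
      proof (intro conjI)
        show "fold_cover G (\<lambda>v. card (L v)) L H"
          unfolding LH by (rule fold_cover_list_cover[OF G S(2)])
        show "\<forall>v\<in>verts G. card (L v) \<le> f v - dp_removed (take i ?q) v"
          using S(3) by (auto simp: LH take_lift_play)
        show "\<exists>v\<in>verts G. 0 < card (L v)" using S(1,2) by (auto simp: LH)
        show "\<forall>j<i. \<forall>L' H' I'. ?q ! j = ((L', H'), I') \<longrightarrow> verts H \<inter> verts H' = {}"
          using i by (auto simp: LH nth_lift_play lift_move_def list_cover_def)
      qed
    qed
    have over: "dp_game_over G f ?q"
      using p(3) by (simp add: dp_game_over_def list_game_over_def)
    have ans: "snd (p ! i) = {v \<in> fst (p ! i). prod_encode (i, v) \<in> snd (?q ! i)}" if "i < length p" for i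
      using p(1) that by (simp add: follows_def \<tau>_def nth_lift_play)
    have win: "dp_painter_legal ?q" "dp_painter_wins G ?q"
      using \<sigma>[OF follows_lift_play legal over] by auto
    have "independent_in (induced_subgraph G (fst (p ! i))) (snd (p ! i))" if i: "i < length p" for i
    proof -
      have "?q ! i \<in> set ?q" using i by (intro nth_mem) simp
      then have "independent_in (list_cover G i (fst (p ! i))) (snd (?q ! i))"
        using win(1) i by (auto simp: dp_painter_legal_def nth_lift_play lift_move_def)
      then show ?thesis
        using edges_list_cover_iff[of i _ _ G "fst (p ! i)"]
        by (simp add: ans[OF i] independent_in_def induced_subgraph_def) blast
    qed
    then have "list_painter_legal G p"
      by (force simp: list_painter_legal_def in_set_conv_nth)
    moreover have "list_painter_wins G p"
      unfolding list_painter_wins_def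
    proof
      fix v assume "v \<in> verts G"
      then obtain L H I where "((L, H), I) \<in> set ?q" "I \<inter> L v \<noteq> {}"
        using win(2) by (fastforce simp: dp_painter_wins_def)
      then obtain i where i: "i < length p" "?q ! i = ((L, H), I)" "I \<inter> L v \<noteq> {}"
        by (auto simp: in_set_conv_nth)
      then have "v \<in> snd (p ! i)"
        by (auto simp: ans nth_lift_play lift_move_def list_cover_lists_def split: if_splits)
      then show "\<exists>(S, I)\<in>set p. v \<in> I"
        using i(1) by (intro bexI[of _ "p ! i"]) (auto split: prod.split)
    qed
    ultimately show ?thesis ..
  qed
  then show ?thesis unfolding paintable_def by blast
qed

section \<open>A greedy strategy for Painter\<close>

lemma fold_cover_adjacent_distinct:
  assumes "fold_cover G f L H" "{c, d} \<in> edges H"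
  shows "c \<noteq> d"
proof -
  have "simple_graph H" using assms(1) by (simp add: fold_cover_def)
  then have "card {c, d} = 2" using assms(2) unfolding simple_graph_def by blast
  then show ?thesis by auto
qed

lemma fold_cover_unique_neighbor:
  assumes H: "fold_cover G f L H" and uv: "u \<in> verts G" "v \<in> verts G" "u \<noteq> v"
    and c: "c \<in> L u" and d: "d \<in> L v" "d' \<in> L v" and e: "{c, d} \<in> edges H" "{c, d'} \<in> edges H"
  shows "d = d'"
proof -
  have mem: "{c, d} \<in> edges_between H (L u) (L v)" "{c, d'} \<in> edges_between H (L u) (L v)"
    using c d e by (auto simp: edges_between_def)
  moreover have "matching (edges_between H (L u) (L v))" if "{u, v} \<in> edges G"
    using H uv that by (simp add: fold_cover_def)
  moreover have "edges_between H (L u) (L v) = {}" if "{u, v} \<notin> edges G"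
    using H uv that by (simp add: fold_cover_def)
  ultimately have "matching (edges_between H (L u) (L v))" by blast
  then have "{c, d} = {c, d'} \<or> {c, d} \<inter> {c, d'} = {}"
    using mem unfolding matching_def pairwise_def disjnt_def by metis
  then have "{c, d} = {c, d'}" by simp
  then show ?thesis by (auto simp: doubleton_eq_iff)
qed

definition dp_colored :: "'a graph \<Rightarrow> 'a dp_play \<Rightarrow> 'a set" where
  "dp_colored G p = {v \<in> verts G. \<exists>x\<in>set p. snd x \<inter> fst (fst x) v \<noteq> {}}"

lemma dp_colored_snoc:
  "dp_colored G (p @ [((L, H), I)]) = dp_colored G p \<union> {v \<in> verts G. I \<inter> L v \<noteq> {}}"
  by (auto simp: dp_colored_def)

text \<open>The answer is a maximal independent set among the colors of vertices that are still uncolored.\<close>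

definition greedy_answer :: "'a graph \<Rightarrow> 'a dp_play \<Rightarrow> 'a dp_move \<Rightarrow> nat set \<Rightarrow> bool" where
  "greedy_answer G p m I \<longleftrightarrow>
     (let (L, H) = m; C = (\<Union>v\<in>verts G - dp_colored G p. L v)
      in independent_in H I \<and> I \<subseteq> C \<and> (\<forall>c\<in>C - I. \<not> independent_in H (insert c I)))"

lemma greedy_answer_exists:
  assumes "finite (verts H)"
  shows "\<exists>I. greedy_answer G p (L, H) I"
proof -
  define C where "C = (\<Union>v\<in>verts G - dp_colored G p. L v)"
  define P where "P = {I. independent_in H I \<and> I \<subseteq> C}"
  have "P \<subseteq> Pow (verts H)" by (auto simp: P_def independent_in_def)
  then have "finite P" using assms by (meson finite_Pow_iff finite_subset)
  moreover have "{} \<in> P" by (simp add: P_def independent_in_def)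
  ultimately obtain I where I: "I \<in> P" "\<And>J. J \<in> P \<Longrightarrow> I \<subseteq> J \<Longrightarrow> J = I"
    using finite_has_maximal[of P] by blast
  have "greedy_answer G p (L, H) I"
    unfolding greedy_answer_def Let_def prod.case C_def[symmetric]
    using I(1) I(2)[of "insert _ I"] by (auto simp: P_def)
  then show ?thesis ..
qed

text \<open>By maximality every color above a vertex that stays uncolored is adjacent to a chosen color. The chosen
colors lie above distinct newly colored vertices, and each of them is matched to at most one color of \<open>v\<close>.\<close>

lemma greedy_turn:
  assumes cov: "fold_cover G f L H" and G: "finite (verts G)"
    and I: "greedy_answer G p (L, H) I"
    and v: "v \<in> verts G" "v \<notin> dp_colored G (p @ [((L, H), I)])"
  shows "card (L v) \<le> card (dp_colored G (p @ [((L, H), I)]) - dp_colored G p)"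
proof -
  let ?N = "dp_colored G (p @ [((L, H), I)]) - dp_colored G p"
  define C where "C = (\<Union>v\<in>verts G - dp_colored G p. L v)"
  have I: "independent_in H I" "I \<subseteq> C" "\<And>c. c \<in> C \<Longrightarrow> c \<notin> I \<Longrightarrow> \<not> independent_in H (insert c I)"
    using I by (auto simp: greedy_answer_def C_def)
  have v': "v \<notin> dp_colored G p" "I \<inter> L v = {}"
    using v by (auto simp: dp_colored_def)
  have "\<exists>u d. u \<in> ?N \<and> u \<noteq> v \<and> d \<in> I \<inter> L u \<and> {d, c} \<in> edges H" if c: "c \<in> L v" for c
  proof -
    have cC: "c \<in> C" "c \<notin> I" using c v v' by (auto simp: C_def)
    have cH: "c \<in> verts H" using cov c v(1) by (auto simp: fold_cover_def)
    have "{c, c} \<notin> edges H" using fold_cover_adjacent_distinct[OF cov, of c c] by blast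
    then obtain d where d: "d \<in> I" "{d, c} \<in> edges H"
      using I(1) I(3)[OF cC] cH by (auto simp: independent_in_def insert_commute)
    then obtain u where u: "u \<in> verts G" "u \<notin> dp_colored G p" "d \<in> L u"
      using I(2) by (auto simp: C_def)
    have "u \<in> ?N" using u d by (auto simp: dp_colored_def)
    moreover have "u \<noteq> v" using v'(2) u d by blast
    ultimately show ?thesis using u d by blast
  qed
  then obtain h g where hg: "\<And>c. c \<in> L v \<Longrightarrow> h c \<in> ?N \<and> h c \<noteq> v \<and> g c \<in> I \<inter> L (h c) \<and> {g c, c} \<in> edges H"
    by metis
  have "inj_on h (L v)"
  proof (rule inj_onI)
    fix c c' assume cc: "c \<in> L v" "c' \<in> L v" "h c = h c'"
    have hv: "h c \<in> verts G" using hg[OF cc(1)] by (auto simp: dp_colored_def)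
    have "clique_in H (L (h c))" using cov hv by (auto simp: fold_cover_def)
    then have "g c = g c'"
      using hg[OF cc(1)] hg[OF cc(2)] cc(3) I(1) unfolding clique_in_def independent_in_def
      by (metis IntD1 IntD2)
    then show "c = c'"
      using fold_cover_unique_neighbor[OF cov hv v(1), of "g c" c c'] hg[OF cc(1)] hg[OF cc(2)] cc by auto
  qed
  moreover have "h ` L v \<subseteq> ?N" using hg by blast
  moreover have "finite ?N" using G by (simp add: dp_colored_def)
  ultimately show ?thesis by (rule card_inj_on_le)
qed

text \<open>Legality of one turn, so that legality of a play can be used in an induction on its last turn.\<close>

definition dp_turn_legal :: "'a graph \<Rightarrow> ('a \<Rightarrow> nat) \<Rightarrow> 'a dp_play \<Rightarrow> 'a dp_move \<Rightarrow> bool" where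
  "dp_turn_legal G f p m \<longleftrightarrow>
     fold_cover G (\<lambda>v. card (fst m v)) (fst m) (snd m) \<and>
     (\<forall>v\<in>verts G. card (fst m v) \<le> f v - dp_removed p v) \<and>
     (\<exists>v\<in>verts G. card (fst m v) > 0) \<and>
     (\<forall>j<length p. verts (snd m) \<inter> verts (snd (fst (p ! j))) = {})"

lemma all_turn_iff: "(\<forall>L H I. x = ((L, H), I) \<longrightarrow> P L H) \<longleftrightarrow> P (fst (fst x)) (snd (fst x))"
proof -
  obtain L H I where "x = ((L, H), I)" by (metis surj_pair)
  then show ?thesis by simp
qed

lemma dp_lister_legal_iff:
  "dp_lister_legal G f p \<longleftrightarrow> (\<forall>i<length p. dp_turn_legal G f (take i p) (fst (p ! i)))"
  unfolding dp_lister_legal_def dp_turn_legal_def all_turn_iff by simp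

lemma dp_lister_legal_snoc:
  "dp_lister_legal G f (p @ [x]) \<longleftrightarrow> dp_lister_legal G f p \<and> dp_turn_legal G f p (fst x)"
  unfolding dp_lister_legal_iff by (auto simp: nth_append less_Suc_eq)

text \<open>With greedy answers an uncolored vertex never loses more tokens than there are colored
vertices, so it cannot run out of tokens.\<close>

lemma DP_paintable_card_verts:
  assumes G: "finite (verts G)"
  shows "DP_paintable G (\<lambda>_. card (verts G))"
proof -
  define \<sigma> :: "('a dp_move, nat set) strategy" where "\<sigma> p m = (SOME I. greedy_answer G p m I)" for p m
  have answer: "greedy_answer G p (L, H) (\<sigma> p (L, H))" if "fold_cover G f L H" for f p L H
  proof -
    have "finite (verts H)" using that unfolding fold_cover_def simple_graph_def by blast
    from someI_ex[OF greedy_answer_exists[OF this, of G p L]] show ?thesis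
      unfolding \<sigma>_def .
  qed
  have main: "dp_painter_legal p \<and> (\<forall>v\<in>verts G - dp_colored G p. dp_removed p v \<le> card (dp_colored G p))"
    if "follows \<sigma> p" "dp_lister_legal G f p" for p f
    using that
  proof (induction p rule: rev_induct)
    case Nil
    then show ?case by (simp add: dp_painter_legal_def dp_removed_def)
  next
    case (snoc x p)
    obtain L H I where x: "x = ((L, H), I)" by (metis prod.exhaust)
    have legal: "dp_lister_legal G f p" "fold_cover G (\<lambda>v. card (L v)) L H"
      using snoc.prems(2) by (auto simp: dp_lister_legal_snoc dp_turn_legal_def x)
    have I: "greedy_answer G p (L, H) I" using answer[OF legal(2)] snoc.prems(1) by (simp add: x)
    have IH: "dp_painter_legal p" "\<And>v. v \<in> verts G - dp_colored G p \<Longrightarrow> dp_removed p v \<le> card (dp_colored G p)"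
      using snoc.IH snoc.prems legal by auto
    have sub: "dp_colored G p \<subseteq> dp_colored G (p @ [x])" "finite (dp_colored G (p @ [x]))"
      using G by (auto simp: x dp_colored_snoc) (simp add: dp_colored_def)
    have "dp_removed (p @ [x]) v \<le> card (dp_colored G (p @ [x]))"
      if v: "v \<in> verts G - dp_colored G (p @ [x])" for v
    proof -
      have "dp_removed (p @ [x]) v = dp_removed p v + card (L v)"
        by (simp add: dp_removed_def x)
      also have "\<dots> \<le> card (dp_colored G p) + card (dp_colored G (p @ [x]) - dp_colored G p)"
      proof (rule add_mono)
        show "dp_removed p v \<le> card (dp_colored G p)" using v sub by (intro IH(2)) blast
        show "card (L v) \<le> card (dp_colored G (p @ [x]) - dp_colored G p)"
          using greedy_turn[OF legal(2) G I, of v] v by (simp add: x)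
      qed
      also have "\<dots> = card (dp_colored G (p @ [x]))"
        using sub by (metis card_Diff_subset card_mono finite_subset le_add_diff_inverse)
      finally show ?thesis .
    qed
    moreover have "dp_painter_legal (p @ [x])"
      using IH(1) I by (simp add: dp_painter_legal_def x greedy_answer_def Let_def)
    ultimately show ?case by blast
  qed
  show ?thesis
    unfolding DP_paintable_def
  proof (intro exI[of _ \<sigma>] allI impI)
    fix p assume p: "follows \<sigma> p \<and> dp_lister_legal G (\<lambda>_. card (verts G)) p \<and> dp_game_over G (\<lambda>_. card (verts G)) p"
    have m: "dp_painter_legal p" "\<And>v. v \<in> verts G - dp_colored G p \<Longrightarrow> dp_removed p v \<le> card (dp_colored G p)"
      using main[of p "\<lambda>_. card (verts G)"] p by simp_all
    have sub: "dp_colored G p \<subseteq> verts G" by (auto simp: dp_colored_def)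
    have "v \<in> dp_colored G p" if v: "v \<in> verts G" for v
    proof (rule ccontr)
      assume nv: "v \<notin> dp_colored G p"
      then have "dp_colored G p \<subset> verts G" using v sub by blast
      then have "card (dp_colored G p) < card (verts G)" by (rule psubset_card_mono[OF G])
      moreover have "card (verts G) \<le> dp_removed p v" using p v by (simp add: dp_game_over_def)
      moreover have "dp_removed p v \<le> card (dp_colored G p)" using m(2) v nv by simp
      ultimately show False by simp
    qed
    then have "dp_painter_wins G p"
      by (simp add: dp_painter_wins_def dp_colored_def case_prod_beta)
    then show "dp_painter_legal p \<and> dp_painter_wins G p" using m(1) by simp
  qed
qed

section \<open>Choosing independent colors in a cover\<close>

lemma fold_cover_finite:
  assumes "fold_cover G f L H" "v \<in> verts G"
  shows "finite (L v)"
proof -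
  have "simple_graph H" and vH: "verts H = (\<Union>v\<in>verts G. L v)"
    using assms(1) by (simp_all add: fold_cover_def)
  then have "finite (verts H)" by (simp add: simple_graph_def)
  moreover have "L v \<subseteq> verts H" using assms(2) vH by blast
  ultimately show ?thesis by (rule finite_subset[rotated])
qed

lemma DP_colorableI:
  fixes G :: "'a graph"
  assumes "\<And>(L :: 'a \<Rightarrow> nat set) H. fold_cover G f L H \<Longrightarrow>
      \<exists>\<phi>. (\<forall>v\<in>verts G. \<phi> v \<in> L v) \<and>
          (\<forall>u\<in>verts G. \<forall>v\<in>verts G. {u, v} \<in> edges G \<longrightarrow> {\<phi> u, \<phi> v} \<notin> edges H)"
  shows "DP_colorable G f"
  unfolding DP_colorable_def
proof (intro allI impI)
  fix L :: "'a \<Rightarrow> nat set" and H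
  assume cov: "fold_cover G f L H"
  from assms[OF cov] obtain \<phi> where "(\<forall>v\<in>verts G. \<phi> v \<in> L v) \<and>
      (\<forall>u\<in>verts G. \<forall>v\<in>verts G. {u, v} \<in> edges G \<longrightarrow> {\<phi> u, \<phi> v} \<notin> edges H)" ..
  then have \<phi>: "\<And>v. v \<in> verts G \<Longrightarrow> \<phi> v \<in> L v"
      "\<And>u v. u \<in> verts G \<Longrightarrow> v \<in> verts G \<Longrightarrow> {u, v} \<in> edges G \<Longrightarrow> {\<phi> u, \<phi> v} \<notin> edges H"
    by simp_all
  have disj: "disjoint_family_on L (verts G)" and vH: "verts H = (\<Union>v\<in>verts G. L v)"
    using cov by (simp_all add: fold_cover_def)
  have nonadj: "edges_between H (L u) (L v) = {}"
    if "u \<in> verts G" "v \<in> verts G" "u \<noteq> v" "{u, v} \<notin> edges G" for u v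
    using cov that by (simp add: fold_cover_def)
  have "inj_on \<phi> (verts G)"
  proof (rule inj_onI, rule ccontr)
    fix u v assume uv: "u \<in> verts G" "v \<in> verts G" "\<phi> u = \<phi> v" "u \<noteq> v"
    then have "L u \<inter> L v = {}" using disj by (simp add: disjoint_family_on_def)
    then show False using \<phi>(1)[OF uv(1)] \<phi>(1)[OF uv(2)] uv(3) by auto
  qed
  then have "card (\<phi> ` verts G) = card (verts G)" by (rule card_image)
  moreover have "{\<phi> u, \<phi> v} \<notin> edges H" if uv: "u \<in> verts G" "v \<in> verts G" for u v
  proof
    assume e: "{\<phi> u, \<phi> v} \<in> edges H"
    then have "u \<noteq> v" using fold_cover_adjacent_distinct[OF cov e] by blast
    have "{\<phi> u, \<phi> v} \<in> edges_between H (L u) (L v)"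
      using e \<phi>(1) uv by (auto simp: edges_between_def)
    then have "{u, v} \<in> edges G" using nonadj[OF uv \<open>u \<noteq> v\<close>] by auto
    then show False using \<phi>(2)[OF uv] e by simp
  qed
  then have "independent_in H (\<phi> ` verts G)"
    using \<phi>(1) vH by (auto simp: independent_in_def)
  ultimately show "\<exists>I. independent_in H I \<and> card I = card (verts G)" by blast
qed

text \<open>A greedy choice that starts with the shortest list. Each choice deletes at most one color from every
other list, which the decrease of \<open>card S\<close> by one compensates, so no deficit grows. The bound
\<open>card S\<close> decreases as well, but so does the sum, because the vertex with the largest deficit leaves it,
unless all deficits are zero.\<close>

lemma small_deficit_transversal:
  assumes cov: "fold_cover G f L H" and fin: "finite S" and "S \<subseteq> verts G"
    and "\<And>v. v \<in> S \<Longrightarrow> R v \<subseteq> L v"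
    and "S \<noteq> {} \<Longrightarrow> (\<Sum>v\<in>S. card S - card (R v)) < card S"
  shows "\<exists>\<psi>. (\<forall>v\<in>S. \<psi> v \<in> R v) \<and> (\<forall>u\<in>S. \<forall>v\<in>S. {\<psi> u, \<psi> v} \<notin> edges H)"
  using fin assms(3-5)
proof (induction "card S" arbitrary: S R)
  case 0
  then show ?case by auto
next
  case (Suc n)
  have n: "card S = Suc n" "S \<noteq> {}" using Suc.hyps(2) by auto
  define d where "d v = card S - card (R v)" for v
  have "Max (d ` S) \<in> d ` S" using Suc.prems(1) n(2) by (intro Max_in) auto
  then obtain v where "v \<in> S" "d v = Max (d ` S)" by auto
  then have v: "v \<in> S" "\<And>u. u \<in> S \<Longrightarrow> d u \<le> d v"
    using Suc.prems(1) by simp_all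
  have tot: "(\<Sum>u\<in>S. d u) = d v + (\<Sum>u\<in>S - {v}. d u)"
    using Suc.prems(1) v(1) by (rule sum.remove)
  have small: "(\<Sum>u\<in>S. d u) < card S" using Suc.prems(4) n(2) by (simp add: d_def)
  have "R v \<noteq> {}" using small tot by (auto simp: d_def)
  then obtain c where c: "c \<in> R v" by blast
  define R' where "R' u = {e \<in> R u. {c, e} \<notin> edges H}" for u
  have finR: "finite (R u)" if "u \<in> S" for u
    by (rule finite_subset[OF Suc.prems(3)[OF that] fold_cover_finite[OF cov]])
      (use that Suc.prems(2) in blast)
  have R'_card: "card (R u) \<le> Suc (card (R' u))" if u: "u \<in> S - {v}" for u
  proof -
    have "card (R u - R' u) \<le> Suc 0"
    proof (rule card_le_Suc0_iff_eq[THEN iffD2])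
      show "\<forall>x\<in>R u - R' u. \<forall>y\<in>R u - R' u. x = y"
      proof (intro ballI)
        fix x y assume xy: "x \<in> R u - R' u" "y \<in> R u - R' u"
        show "x = y"
        proof (rule fold_cover_unique_neighbor[OF cov])
          show "v \<in> verts G" "u \<in> verts G" "v \<noteq> u" using u v(1) Suc.prems(2) by auto
          show "c \<in> L v" "x \<in> L u" "y \<in> L u" using u v(1) c xy Suc.prems(3) by auto
          show "{c, x} \<in> edges H" "{c, y} \<in> edges H" using xy by (auto simp: R'_def)
        qed
      qed
    qed (use finR u in auto)
    moreover have "R' u \<subseteq> R u" by (auto simp: R'_def)
    ultimately show ?thesis
      using finR[of u] u card_Diff_subset[of "R' u" "R u"] finite_subset[of "R' u" "R u"] by auto
  qed
  have card': "card (S - {v}) = n" using n v(1) Suc.prems(1) by simp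
  have "\<exists>\<psi>. (\<forall>u\<in>S - {v}. \<psi> u \<in> R' u) \<and> (\<forall>u\<in>S - {v}. \<forall>w\<in>S - {v}. {\<psi> u, \<psi> w} \<notin> edges H)"
  proof (rule Suc.hyps(1))
    show "S - {v} \<subseteq> verts G" using Suc.prems(2) by blast
    show "R' u \<subseteq> L u" if "u \<in> S - {v}" for u using Suc.prems(3)[of u] that by (auto simp: R'_def)
    assume ne: "S - {v} \<noteq> {}"
    have "(\<Sum>u\<in>S - {v}. card (S - {v}) - card (R' u)) \<le> (\<Sum>u\<in>S - {v}. d u)"
      using R'_card by (intro sum_mono) (fastforce simp: d_def card' n(1))
    also have "\<dots> < card (S - {v})"
    proof (cases "d v = 0")
      case True
      then have "(\<Sum>u\<in>S - {v}. d u) = 0" using v(2) Suc.prems(1) by auto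
      moreover have "card (S - {v}) > 0" using ne Suc.prems(1) by (simp add: card_gt_0_iff)
      ultimately show ?thesis by simp
    next
      case False
      then show ?thesis using tot small card' n(1) by linarith
    qed
    finally show "(\<Sum>u\<in>S - {v}. card (S - {v}) - card (R' u)) < card (S - {v})" .
  qed (use card' Suc.prems(1) in auto)
  then obtain \<psi> where "(\<forall>u\<in>S - {v}. \<psi> u \<in> R' u) \<and>
      (\<forall>u\<in>S - {v}. \<forall>w\<in>S - {v}. {\<psi> u, \<psi> w} \<notin> edges H)" ..
  then have \<psi>: "\<And>u. u \<in> S - {v} \<Longrightarrow> \<psi> u \<in> R' u"
      "\<And>u w. u \<in> S - {v} \<Longrightarrow> w \<in> S - {v} \<Longrightarrow> {\<psi> u, \<psi> w} \<notin> edges H"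
    by simp_all
  have cc: "{c, c} \<notin> edges H" using fold_cover_adjacent_distinct[OF cov, of c c] by blast
  have "(\<psi>(v := c)) u \<in> R u" if "u \<in> S" for u
    using \<psi>(1)[of u] c that by (auto simp: R'_def)
  moreover have "{(\<psi>(v := c)) u, (\<psi>(v := c)) w} \<notin> edges H" if "u \<in> S" "w \<in> S" for u w
    using \<psi>(1)[of u] \<psi>(1)[of w] \<psi>(2)[of u w] cc that by (auto simp: R'_def insert_commute)
  ultimately show ?case by (intro exI[of _ "\<psi>(v := c)"]) simp
qed

text \<open>A union bound. For fixed \<open>\<tau>\<close> and a fixed set of \<open>m\<close> elements of \<open>W\<close>, at most a fraction \<open>(m / k) ^ m\<close> of all choices
hits \<open>B \<tau>\<close> at all these elements; there are at most \<open>2 ^ card W\<close> such sets.\<close>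

lemma choice_with_few_hits:
  fixes k m :: nat
  assumes W: "finite W" "0 < m" "m \<le> card W" and T: "finite T"
    and L: "\<And>w. w \<in> W \<Longrightarrow> card (L w) = k"
    and B: "\<And>\<tau> w. \<tau> \<in> T \<Longrightarrow> w \<in> W \<Longrightarrow> B \<tau> w \<subseteq> L w \<and> card (B \<tau> w) \<le> m"
    and small: "card T * 2 ^ card W * m ^ m < k ^ m"
  shows "\<exists>\<phi>\<in>Pi\<^sub>E W L. \<forall>\<tau>\<in>T. card {w \<in> W. \<phi> w \<in> B \<tau> w} < m"
proof (rule ccontr)
  assume contra: "\<not> ?thesis"
  define \<Q> where "\<Q> = {Q. Q \<subseteq> W \<and> card Q = m}"
  define P where "P \<tau> Q = Pi\<^sub>E W (\<lambda>w. if w \<in> Q then B \<tau> w else L w)" for \<tau> Q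
  have fin\<Q>: "finite \<Q>" using W(1) by (auto simp: \<Q>_def)
  have kpos: "k > 0" using small W(2) by (cases k) (auto simp: power_0_left)
  have finL: "finite (L w)" if "w \<in> W" for w
    using L[OF that] kpos card.infinite by fastforce
  have finP: "finite (P (fst x) (snd x))" if "x \<in> T \<times> \<Q>" for x
    unfolding P_def
  proof (rule finite_PiE[OF W(1)])
    fix w assume w: "w \<in> W"
    have "finite (B (fst x) w)" using B[of "fst x" w] finL[OF w] that w finite_subset by auto
    then show "finite (if w \<in> snd x then B (fst x) w else L w)" using finL[OF w] by simp
  qed
  have "Pi\<^sub>E W L \<subseteq> (\<Union>x\<in>T \<times> \<Q>. P (fst x) (snd x))"
  proof
    fix \<phi> assume \<phi>: "\<phi> \<in> Pi\<^sub>E W L"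
    with contra obtain \<tau> where \<tau>: "\<tau> \<in> T" "m \<le> card {w \<in> W. \<phi> w \<in> B \<tau> w}"
      by (auto simp: not_less)
    then obtain Q where Q: "Q \<subseteq> {w \<in> W. \<phi> w \<in> B \<tau> w}" "card Q = m"
      using obtain_subset_with_card_n by blast
    then have "\<phi> \<in> P \<tau> Q" using \<phi> by (auto simp: P_def PiE_def Pi_def)
    moreover have "Q \<in> \<Q>" using Q by (auto simp: \<Q>_def)
    ultimately show "\<phi> \<in> (\<Union>x\<in>T \<times> \<Q>. P (fst x) (snd x))" using \<tau>(1) by force
  qed
  moreover have "finite (\<Union>x\<in>T \<times> \<Q>. P (fst x) (snd x))"
    using T fin\<Q> finP by (intro finite_UN_I) auto
  ultimately have "card (Pi\<^sub>E W L) \<le> card (\<Union>x\<in>T \<times> \<Q>. P (fst x) (snd x))"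
    by (rule card_mono[rotated])
  also have "\<dots> \<le> (\<Sum>x\<in>T \<times> \<Q>. card (P (fst x) (snd x)))"
    using T fin\<Q> by (intro card_UN_le) auto
  also have "\<dots> \<le> (\<Sum>x\<in>T \<times> \<Q>. m ^ m * k ^ (card W - m))"
  proof (rule sum_mono)
    fix x assume "x \<in> T \<times> \<Q>"
    then obtain \<tau> Q where x: "x = (\<tau>, Q)" "\<tau> \<in> T" "Q \<subseteq> W" "card Q = m" by (auto simp: \<Q>_def)
    have "card (P \<tau> Q) = (\<Prod>w\<in>W. card (if w \<in> Q then B \<tau> w else L w))"
      unfolding P_def by (rule card_PiE[OF W(1)])
    also have "\<dots> = (\<Prod>w\<in>W - Q. card (L w)) * (\<Prod>w\<in>Q. card (B \<tau> w))"
      using x(3) by (subst prod.subset_diff[OF x(3) W(1)]) (auto intro!: arg_cong2[where f = "(*)"] prod.cong)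
    also have "(\<Prod>w\<in>W - Q. card (L w)) = k ^ (card W - m)"
      using L x W(1) by (simp add: card_Diff_subset finite_subset)
    also have "(\<Prod>w\<in>Q. card (B \<tau> w)) \<le> (\<Prod>w\<in>Q. m)"
    proof (rule prod_mono)
      fix w assume "w \<in> Q"
      then have w: "w \<in> W" using x by blast
      have "finite (L w)" by (rule finL[OF w])
      show "0 \<le> card (B \<tau> w) \<and> card (B \<tau> w) \<le> m"
        using B[OF x(2) w] by simp
    qed
    finally show "card (P (fst x) (snd x)) \<le> m ^ m * k ^ (card W - m)"
      using x by (simp add: mult.commute)
  qed
  also have "\<dots> = card T * card \<Q> * (m ^ m * k ^ (card W - m))"
    by (simp add: card_cartesian_product)
  also have "\<dots> \<le> card T * 2 ^ card W * (m ^ m * k ^ (card W - m))"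
  proof -
    have "card \<Q> \<le> card (Pow W)" using W(1) by (intro card_mono) (auto simp: \<Q>_def)
    then have "card \<Q> \<le> 2 ^ card W" using W(1) by (simp add: card_Pow)
    then show ?thesis by (intro mult_right_mono mult_left_mono) auto
  qed
  also have "\<dots> = card T * 2 ^ card W * m ^ m * k ^ (card W - m)" by simp
  also have "\<dots> < k ^ m * k ^ (card W - m)"
    using small kpos by (intro mult_strict_right_mono) auto
  also have "\<dots> = k ^ card W" using W(3) by (simp flip: power_add)
  also have "\<dots> = card (Pi\<^sub>E W L)" using W(1) L by (simp add: card_PiE)
  finally show False by simp
qed

lemma card_neighbors_le:
  assumes cov: "fold_cover G f L H" and uv: "u \<in> verts G" "v \<in> verts G" "u \<noteq> v"
    and R: "R \<subseteq> L v"
  shows "card {x \<in> L u. \<exists>d\<in>R. {x, d} \<in> edges H} \<le> card R"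
proof -
  have fin: "finite R" using R fold_cover_finite[OF cov uv(2)] by (rule finite_subset)
  have "{x \<in> L u. \<exists>d\<in>R. {x, d} \<in> edges H} = (\<Union>d\<in>R. {x \<in> L u. {x, d} \<in> edges H})" by auto
  also have "card \<dots> \<le> (\<Sum>d\<in>R. card {x \<in> L u. {x, d} \<in> edges H})"
    by (rule card_UN_le[OF fin])
  also have "\<dots> \<le> (\<Sum>d\<in>R. 1)"
  proof (rule sum_mono)
    fix d assume d: "d \<in> R"
    have "x = y" if "x \<in> {x \<in> L u. {x, d} \<in> edges H}" "y \<in> {x \<in> L u. {x, d} \<in> edges H}" for x y
      using fold_cover_unique_neighbor[OF cov uv(2) uv(1) uv(3)[symmetric], of d x y] that d R
      by (auto simp: insert_commute)
    then show "card {x \<in> L u. {x, d} \<in> edges H} \<le> 1"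
      using fold_cover_finite[OF cov uv(1)]
      by (simp only: One_nat_def card_le_Suc0_iff_eq[OF finite_Collect_conjI[OF disjI1]] Collect_mem_eq) blast
  qed
  finally show ?thesis by simp
qed

text \<open>An element of \<open>X\<close> blocks at most one color of \<open>u\<close>, since \<open>\<phi> x\<close> has at most one neighbor in \<open>L u\<close>.\<close>

lemma card_blocked_le:
  assumes cov: "fold_cover G f L H" and X: "finite X" "X \<subseteq> verts G" "u \<in> verts G" "u \<notin> X"
    and \<phi>: "\<And>x. x \<in> X \<Longrightarrow> \<phi> x \<in> L x" and R: "R \<subseteq> L u"
  shows "card {d \<in> R. \<exists>x\<in>X. {\<phi> x, d} \<in> edges H} \<le> card {x \<in> X. \<exists>d\<in>R. {\<phi> x, d} \<in> edges H}"
proof -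
  let ?D = "{d \<in> R. \<exists>x\<in>X. {\<phi> x, d} \<in> edges H}"
  have "\<forall>d\<in>?D. \<exists>x. x \<in> X \<and> {\<phi> x, d} \<in> edges H" by blast
  then obtain h where "\<forall>d\<in>?D. h d \<in> X \<and> {\<phi> (h d), d} \<in> edges H" by (rule bchoice[THEN exE])
  then have h: "\<And>d. d \<in> ?D \<Longrightarrow> h d \<in> X" "\<And>d. d \<in> ?D \<Longrightarrow> {\<phi> (h d), d} \<in> edges H" by simp_all
  show ?thesis
  proof (rule card_inj_on_le[of h])
    show "inj_on h ?D"
    proof (rule inj_onI)
      fix d d' assume d: "d \<in> ?D" "d' \<in> ?D" "h d = h d'"
      show "d = d'"
      proof (rule fold_cover_unique_neighbor[OF cov])
        show "h d \<in> verts G" "u \<in> verts G" "h d \<noteq> u" "\<phi> (h d) \<in> L (h d)"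
          using h(1)[OF d(1)] X \<phi> by auto
        show "d \<in> L u" "d' \<in> L u" using d R by auto
        show "{\<phi> (h d), d} \<in> edges H" "{\<phi> (h d), d'} \<in> edges H"
          using h(2)[OF d(1)] h(2)[OF d(2)] d(3) by simp_all
      qed
    qed
    show "h ` ?D \<subseteq> {x \<in> X. \<exists>d\<in>R. {\<phi> x, d} \<in> edges H}" using h by fastforce
  qed (use X in simp)
qed

section \<open>The graph with a gap\<close>

text \<open>The arguments of a vertex are, in this order, the copy \<open>c\<close>, for clique vertices the clique \<open>\<tau>\<close>, the index \<open>i\<close> of the
position in the clique or of the group of hubs, and the number \<open>l\<close> within the group. Lists of different lengths keep the
three kinds of vertices apart; the final \<open>0\<close> serves only for that.\<close>

definition common_vertex :: "nat \<Rightarrow> nat" where "common_vertex j = list_encode [j]"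
definition clique_vertex :: "nat \<Rightarrow> nat \<Rightarrow> nat \<Rightarrow> nat" where "clique_vertex c \<tau> i = list_encode [c, \<tau>, i]"
definition hub_vertex :: "nat \<Rightarrow> nat \<Rightarrow> nat \<Rightarrow> nat" where "hub_vertex c i l = list_encode [c, i, l, 0]"

lemma vertex_inject [simp]:
  "common_vertex j = common_vertex j' \<longleftrightarrow> j = j'"
  "clique_vertex c \<tau> i = clique_vertex c' \<tau>' i' \<longleftrightarrow> c = c' \<and> \<tau> = \<tau>' \<and> i = i'"
  "hub_vertex c i l = hub_vertex c' i' l' \<longleftrightarrow> c = c' \<and> i = i' \<and> l = l'"
  "common_vertex j \<noteq> clique_vertex c \<tau> i" "clique_vertex c \<tau> i \<noteq> common_vertex j" "common_vertex j \<noteq> hub_vertex c i l" "hub_vertex c i l \<noteq> common_vertex j"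
  "clique_vertex c \<tau> i \<noteq> hub_vertex c' i' l" "hub_vertex c' i' l \<noteq> clique_vertex c \<tau> i"
  by (simp_all add: common_vertex_def clique_vertex_def hub_vertex_def list_encode_eq)

definition tokens :: "nat \<Rightarrow> nat \<Rightarrow> nat" where "tokens t z = z + 2 * t"

definition commons :: "nat \<Rightarrow> nat set" where "commons z = common_vertex ` {..<z}"
definition hubs :: "nat \<Rightarrow> nat \<Rightarrow> nat \<Rightarrow> nat set" where "hubs t c i = hub_vertex c i ` {..<t}"
definition gadget_clique :: "nat \<Rightarrow> nat \<Rightarrow> nat \<Rightarrow> nat set" where "gadget_clique t c \<tau> = clique_vertex c \<tau> ` {..t}"

lemma blocks_disjoint:
  "gadget_clique t c \<tau> \<inter> commons z = {}" "hubs t c i \<inter> commons z = {}" "gadget_clique t c \<tau> \<inter> hubs t c' i = {}"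
  "c \<noteq> c' \<or> \<tau> \<noteq> \<tau>' \<Longrightarrow> gadget_clique t c \<tau> \<inter> gadget_clique t c' \<tau>' = {}"
  by (auto simp: commons_def hubs_def gadget_clique_def)

text \<open>Both numbers are chosen for the pigeonhole steps: one copy must survive the attack of \<open>z\<close> vertices, and
among \<open>t + 1\<close> possible indices of survivors one must occur often enough for the attack of \<open>t\<close> hubs.\<close>

definition ncopies :: "nat \<Rightarrow> nat \<Rightarrow> nat" where "ncopies t z = tokens t z ^ z"
definition ncliques :: "nat \<Rightarrow> nat \<Rightarrow> nat" where "ncliques t z = Suc t * tokens t z ^ t"

definition gap_graph :: "nat \<Rightarrow> nat \<Rightarrow> nat graph" where
  "gap_graph t z = \<lparr>verts = commons z \<union> (\<Union>c<ncopies t z. (\<Union>i\<le>t. hubs t c i) \<union> (\<Union>\<tau><ncliques t z. gadget_clique t c \<tau>)),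
     edges = {{common_vertex j, clique_vertex c \<tau> i} | j c \<tau> i. j < z \<and> c < ncopies t z \<and> \<tau> < ncliques t z \<and> i \<le> t} \<union>
       {{hub_vertex c i l, clique_vertex c \<tau> i} | c \<tau> i l. c < ncopies t z \<and> \<tau> < ncliques t z \<and> i \<le> t \<and> l < t} \<union>
       {{clique_vertex c \<tau> i, clique_vertex c \<tau> i'} | c \<tau> i i'. c < ncopies t z \<and> \<tau> < ncliques t z \<and> i \<le> t \<and> i' \<le> t \<and> i \<noteq> i'}\<rparr>"

lemma simple_gap_graph: "simple_graph (gap_graph t z)"
proof -
  have "finite (verts (gap_graph t z))"
    by (simp add: gap_graph_def commons_def hubs_def gadget_clique_def)
  moreover have "e \<subseteq> verts (gap_graph t z) \<and> card e = 2" if "e \<in> edges (gap_graph t z)" for e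
    using that by (fastforce simp: gap_graph_def commons_def hubs_def gadget_clique_def card_2_iff doubleton_eq_iff)
  ultimately show ?thesis by (simp add: simple_graph_def)
qed

lemma gap_graph_edges:
  assumes "c < ncopies t z" "\<tau> < ncliques t z" "i \<le> t"
  shows "j < z \<Longrightarrow> {common_vertex j, clique_vertex c \<tau> i} \<in> edges (gap_graph t z)"
    and "l < t \<Longrightarrow> {hub_vertex c i l, clique_vertex c \<tau> i} \<in> edges (gap_graph t z)"
    and "i' \<le> t \<Longrightarrow> i \<noteq> i' \<Longrightarrow> {clique_vertex c \<tau> i, clique_vertex c \<tau> i'} \<in> edges (gap_graph t z)"
proof -
  show "{common_vertex j, clique_vertex c \<tau> i} \<in> edges (gap_graph t z)" if "j < z"
    unfolding gap_graph_def graph.select_convs by (intro UnI1 CollectI exI conjI) (use assms that in auto)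
  show "{hub_vertex c i l, clique_vertex c \<tau> i} \<in> edges (gap_graph t z)" if "l < t"
    unfolding gap_graph_def graph.select_convs 
    by (intro UnI1[OF UnI2] CollectI exI conjI) (use assms that in auto)
  show "{clique_vertex c \<tau> i, clique_vertex c \<tau> i'} \<in> edges (gap_graph t z)" if "i' \<le> t" "i \<noteq> i'"
    unfolding gap_graph_def graph.select_convs 
    by (rule UnI2) (intro CollectI exI conjI, use assms that in auto)
qed

lemma gap_graph_edgeE:
  assumes "e \<in> edges (gap_graph t z)"
  obtains (zu) j c \<tau> i where "e = {common_vertex j, clique_vertex c \<tau> i}" "j < z" "c < ncopies t z" "\<tau> < ncliques t z" "i \<le> t"
    | (wu) c \<tau> i l where "e = {hub_vertex c i l, clique_vertex c \<tau> i}" "c < ncopies t z" "\<tau> < ncliques t z" "i \<le> t" "l < t"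
    | (uu) c \<tau> i i' where "e = {clique_vertex c \<tau> i, clique_vertex c \<tau> i'}" "c < ncopies t z" "\<tau> < ncliques t z" "i \<le> t" "i' \<le> t" "i \<noteq> i'"
  using assms unfolding gap_graph_def graph.select_convs by (elim UnE CollectE exE conjE) metis+

section \<open>Lister wins on the graph\<close>

text \<open>The end of the game: \<open>g \<tau>\<close> is the index of the survivor in the clique \<open>\<tau>\<close>. The
survivors with the most frequent index are burned by the hubs of that index.\<close>

lemma survivors_lose:
  assumes c: "c < ncopies t z" and g: "\<And>\<tau>. \<tau> < ncliques t z \<Longrightarrow> g \<tau> \<le> t"
    and f: "\<And>v. f v \<le> tokens t z" "\<And>\<tau>. \<tau> < ncliques t z \<Longrightarrow> f (clique_vertex c \<tau> (g \<tau>)) \<le> t"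
  shows "lister_wins (gap_graph t z) f
     ((\<Union>i\<le>t. hubs t c i) \<union> (\<lambda>\<tau>. clique_vertex c \<tau> (g \<tau>)) ` {..<ncliques t z})"
proof -
  let ?T = "ncliques t z"
  have "\<exists>i\<le>t. tokens t z ^ t \<le> card {\<tau>. \<tau> < ?T \<and> g \<tau> = i}"
  proof (rule ccontr)
    assume "\<not> ?thesis"
    then have less: "card {\<tau>. \<tau> < ?T \<and> g \<tau> = i} < tokens t z ^ t" if "i \<in> {..t}" for i
      using that by (meson atMost_iff not_le)
    have "{..<?T} = (\<Union>i\<in>{..t}. {\<tau>. \<tau> < ?T \<and> g \<tau> = i})" using g by auto
    then have "?T = card (\<Union>i\<in>{..t}. {\<tau>. \<tau> < ?T \<and> g \<tau> = i})" by (metis card_lessThan)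
    also have "\<dots> \<le> (\<Sum>i\<in>{..t}. card {\<tau>. \<tau> < ?T \<and> g \<tau> = i})" by (rule card_UN_le) simp
    also have "\<dots> < (\<Sum>i\<in>{..t}. tokens t z ^ t)" using less by (intro sum_strict_mono) auto
    also have "\<dots> = ?T" by (simp add: ncliques_def)
    finally show False by simp
  qed
  then obtain i where i: "i \<le> t" "tokens t z ^ t \<le> card {\<tau>. \<tau> < ?T \<and> g \<tau> = i}" by blast
  let ?J = "{\<tau>. \<tau> < ?T \<and> g \<tau> = i}"
  have cardW: "card (hubs t c i) = t" by (simp add: hubs_def card_image inj_on_def)
  show ?thesis
  proof (rule burn_vertices[where X = "hubs t c i" and J = ?J and B = "\<lambda>\<tau>. {clique_vertex c \<tau> i}" and N = 1 and F = "tokens t z"])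
    show "finite (hubs t c i)" by (simp add: hubs_def)
    show "\<And>x \<tau> v. x \<in> hubs t c i \<Longrightarrow> \<tau> \<in> ?J \<Longrightarrow> v \<in> {clique_vertex c \<tau> i} \<Longrightarrow> {x, v} \<in> edges (gap_graph t z)"
      using c i(1) by (auto simp: hubs_def intro: gap_graph_edges(2))
    show "hubs t c i \<subseteq> (\<Union>i\<le>t. hubs t c i) \<union> (\<lambda>\<tau>. clique_vertex c \<tau> (g \<tau>)) ` {..<?T}" using i(1) by blast
    show "disjoint_family_on (\<lambda>\<tau>. {clique_vertex c \<tau> i}) ?J" by (simp add: disjoint_family_on_def)
    show "\<And>\<tau>. \<tau> \<in> ?J \<Longrightarrow> {clique_vertex c \<tau> i} \<subseteq> (\<Union>i\<le>t. hubs t c i) \<union> (\<lambda>\<tau>. clique_vertex c \<tau> (g \<tau>)) ` {..<?T} - hubs t c i"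
      by (auto simp: hubs_def)
    show "\<And>x. x \<in> hubs t c i \<Longrightarrow> f x \<le> tokens t z" using f(1) by blast
    show "tokens t z ^ card (hubs t c i) * 1 \<le> card ?J" using i(2) by (simp add: cardW)
    fix J' assume J': "J' \<subseteq> ?J" "1 \<le> card J'"
    then obtain \<tau> where \<tau>: "\<tau> \<in> J'" by fastforce
    then have \<tau>': "\<tau> < ?T" "g \<tau> = i" using J'(1) by auto
    show "lister_wins (gap_graph t z) (\<lambda>v. f v - (if v \<in> (\<Union>\<tau>\<in>J'. {clique_vertex c \<tau> i}) then card (hubs t c i) else 0))
        ((\<Union>i\<le>t. hubs t c i) \<union> (\<lambda>\<tau>. clique_vertex c \<tau> (g \<tau>)) ` {..<?T} - hubs t c i - (\<Union>\<tau>\<in>?J - J'. {clique_vertex c \<tau> i}))"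
    proof (rule lister_wins.dead[where v = "clique_vertex c \<tau> i"])
      show "clique_vertex c \<tau> i \<in> (\<Union>i\<le>t. hubs t c i) \<union> (\<lambda>\<tau>. clique_vertex c \<tau> (g \<tau>)) ` {..<?T} - hubs t c i - (\<Union>\<tau>\<in>?J - J'. {clique_vertex c \<tau> i})"
        using \<tau> \<tau>' by (auto simp: hubs_def)
      show "f (clique_vertex c \<tau> i) - (if clique_vertex c \<tau> i \<in> (\<Union>\<tau>\<in>J'. {clique_vertex c \<tau> i}) then card (hubs t c i) else 0) = 0"
        using \<tau> f(2)[OF \<tau>'(1)] \<tau>'(2) by (simp add: cardW)
    qed
  qed
qed

lemma copy_loses:
  assumes c: "c < ncopies t z"
    and f: "\<And>v. f v \<le> tokens t z" "\<And>\<tau> i. \<tau> < ncliques t z \<Longrightarrow> i \<le> t \<Longrightarrow> f (clique_vertex c \<tau> i) \<le> 2 * t"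
  shows "lister_wins (gap_graph t z) f ((\<Union>i\<le>t. hubs t c i) \<union> (\<Union>\<tau><ncliques t z. gadget_clique t c \<tau>))"
proof (rule play_cliques[where J = "{..<ncliques t z}" and K = "gadget_clique t c" and r = t])
  show "\<And>\<tau> x y. \<tau> \<in> {..<ncliques t z} \<Longrightarrow> x \<in> gadget_clique t c \<tau> \<Longrightarrow> y \<in> gadget_clique t c \<tau> \<Longrightarrow> x \<noteq> y \<Longrightarrow>
      {x, y} \<in> edges (gap_graph t z)"
    using c by (auto simp: gadget_clique_def intro: gap_graph_edges(3))
  show "\<And>\<tau>. \<tau> \<in> {..<ncliques t z} \<Longrightarrow> t < card (gadget_clique t c \<tau>)"
    by (simp add: gadget_clique_def card_image inj_on_def)
  fix u assume "\<And>\<tau>. \<tau> \<in> {..<ncliques t z} \<Longrightarrow> u \<tau> \<in> gadget_clique t c \<tau>"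
  then have "\<exists>i\<le>t. u \<tau> = clique_vertex c \<tau> i" if "\<tau> < ncliques t z" for \<tau> using that by (fastforce simp: gadget_clique_def)
  then obtain g where g: "\<And>\<tau>. \<tau> < ncliques t z \<Longrightarrow> g \<tau> \<le> t \<and> u \<tau> = clique_vertex c \<tau> (g \<tau>)" by metis
  let ?f = "\<lambda>v. f v - (if v \<in> u ` {..<ncliques t z} then t else 0)"
  have lose: "lister_wins (gap_graph t z) ?f ((\<Union>i\<le>t. hubs t c i) \<union> (\<lambda>\<tau>. clique_vertex c \<tau> (g \<tau>)) ` {..<ncliques t z})"
  proof (rule survivors_lose[OF c])
    show "?f v \<le> tokens t z" for v using f(1)[of v] by simp
    show "?f (clique_vertex c \<tau> (g \<tau>)) \<le> t" if \<tau>: "\<tau> < ncliques t z" for \<tau>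
    proof -
      have "clique_vertex c \<tau> (g \<tau>) \<in> u ` {..<ncliques t z}" using g[OF \<tau>] \<tau> by (metis imageI lessThan_iff)
      then show ?thesis using f(2)[OF \<tau>, of "g \<tau>"] g[OF \<tau>] by simp
    qed
  qed (use g in blast)
  have sub: "(\<Union>i\<le>t. hubs t c i) \<union> (\<lambda>\<tau>. clique_vertex c \<tau> (g \<tau>)) ` {..<ncliques t z} \<subseteq>
      (\<Union>i\<le>t. hubs t c i) \<union> (\<Union>\<tau><ncliques t z. gadget_clique t c \<tau>) - \<Union> (gadget_clique t c ` {..<ncliques t z}) \<union> u ` {..<ncliques t z}"
    using g by (auto simp: gadget_clique_def hubs_def image_iff)
  show "lister_wins (gap_graph t z) ?f
      ((\<Union>i\<le>t. hubs t c i) \<union> (\<Union>\<tau><ncliques t z. gadget_clique t c \<tau>) - \<Union> (gadget_clique t c ` {..<ncliques t z}) \<union> u ` {..<ncliques t z})"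
    by (rule lister_wins_mono[OF lose order_refl sub])
qed blast

lemma lister_wins_gap_graph:
  "lister_wins (gap_graph t z) (\<lambda>_. tokens t z) (verts (gap_graph t z))"
proof (rule burn_vertices[where X = "commons z" and J = "{..<ncopies t z}" and
      B = "\<lambda>c. \<Union>\<tau><ncliques t z. gadget_clique t c \<tau>" and N = 1 and F = "tokens t z"])
  have cardZ: "card (commons z) = z" by (simp add: commons_def card_image inj_on_def)
  show "finite (commons z)" by (simp add: commons_def)
  show "\<And>x c v. x \<in> commons z \<Longrightarrow> c \<in> {..<ncopies t z} \<Longrightarrow> v \<in> (\<Union>\<tau><ncliques t z. gadget_clique t c \<tau>) \<Longrightarrow>
      {x, v} \<in> edges (gap_graph t z)"
    by (auto simp: commons_def gadget_clique_def intro: gap_graph_edges(1))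
  show "commons z \<subseteq> verts (gap_graph t z)" by (simp add: gap_graph_def)
  show "disjoint_family_on (\<lambda>c. \<Union>\<tau><ncliques t z. gadget_clique t c \<tau>) {..<ncopies t z}"
    by (auto simp: disjoint_family_on_def gadget_clique_def)
  show "(\<Union>\<tau><ncliques t z. gadget_clique t c \<tau>) \<subseteq> verts (gap_graph t z) - commons z" if "c \<in> {..<ncopies t z}" for c
  proof -
    have "(\<Union>\<tau><ncliques t z. gadget_clique t c \<tau>) \<subseteq> verts (gap_graph t z)"
      unfolding gap_graph_def graph.select_convs using that by blast
    then show ?thesis using blocks_disjoint(1) by blast
  qed
  show "tokens t z ^ card (commons z) * 1 \<le> card {..<ncopies t z}" by (simp add: cardZ ncopies_def)
  fix J' assume J': "J' \<subseteq> {..<ncopies t z}" "1 \<le> card J'"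
  then obtain c where c: "c \<in> J'" by fastforce
  let ?f = "\<lambda>v. tokens t z - (if v \<in> (\<Union>c\<in>J'. \<Union>\<tau><ncliques t z. gadget_clique t c \<tau>) then card (commons z) else 0)"
  have lose: "lister_wins (gap_graph t z) ?f ((\<Union>i\<le>t. hubs t c i) \<union> (\<Union>\<tau><ncliques t z. gadget_clique t c \<tau>))"
  proof (rule copy_loses)
    show "c < ncopies t z" using c J' by auto
    fix \<tau> i assume "\<tau> < ncliques t z" "i \<le> t"
    then have "clique_vertex c \<tau> i \<in> (\<Union>c\<in>J'. \<Union>\<tau><ncliques t z. gadget_clique t c \<tau>)" using c by (auto simp: gadget_clique_def)
    then show "?f (clique_vertex c \<tau> i) \<le> 2 * t" by (simp add: cardZ tokens_def)
  qed simp
  have sub: "(\<Union>i\<le>t. hubs t c i) \<union> (\<Union>\<tau><ncliques t z. gadget_clique t c \<tau>) \<subseteq>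
      verts (gap_graph t z) - commons z - \<Union> ((\<lambda>c. \<Union>\<tau><ncliques t z. gadget_clique t c \<tau>) ` ({..<ncopies t z} - J'))"
      (is "?A \<subseteq> verts ?G - _ - ?B")
  proof -
    have "?A \<subseteq> verts ?G"
      unfolding gap_graph_def graph.select_convs using c J' by blast
    moreover have "?A \<inter> commons z = {}" using blocks_disjoint(1,2) by blast
    moreover have "x \<notin> ?B" if "x \<in> ?A" for x
    proof
      assume "x \<in> ?B"
      then obtain c' \<tau>' where x: "c' \<notin> J'" "x \<in> gadget_clique t c' \<tau>'" by blast
      then have "c \<noteq> c'" using c by blast
      from that obtain i \<tau> where "x \<in> hubs t c i \<or> x \<in> gadget_clique t c \<tau>" by blast
      then show False
        using x(2) blocks_disjoint(3)[of t c' \<tau>' c i] blocks_disjoint(4)[of c c' \<tau> \<tau>' t] \<open>c \<noteq> c'\<close> by auto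
    qed
    ultimately show ?thesis by blast
  qed
  show "lister_wins (gap_graph t z) ?f
      (verts (gap_graph t z) - commons z - \<Union> ((\<lambda>c. \<Union>\<tau><ncliques t z. gadget_clique t c \<tau>) ` ({..<ncopies t z} - J')))"
    by (rule lister_wins_mono[OF lose order_refl sub])
qed simp

section \<open>DP-coloring the graph\<close>

definition copy_of :: "nat \<Rightarrow> nat" where "copy_of v = list_decode v ! 0"
definition clique_of :: "nat \<Rightarrow> nat" where "clique_of v = list_decode v ! 1"

lemma copy_of_simps [simp]:
  "copy_of (clique_vertex c \<tau> i) = c" "copy_of (hub_vertex c i l) = c" "clique_of (clique_vertex c \<tau> i) = \<tau>"
  by (simp_all add: copy_of_def clique_of_def clique_vertex_def hub_vertex_def)

lemma gap_graph_vertsI: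
  "j < z \<Longrightarrow> common_vertex j \<in> verts (gap_graph t z)"
  "c < ncopies t z \<Longrightarrow> i \<le> t \<Longrightarrow> l < t \<Longrightarrow> hub_vertex c i l \<in> verts (gap_graph t z)"
  "c < ncopies t z \<Longrightarrow> \<tau> < ncliques t z \<Longrightarrow> i \<le> t \<Longrightarrow> clique_vertex c \<tau> i \<in> verts (gap_graph t z)"
proof -
  show "common_vertex j \<in> verts (gap_graph t z)" if "j < z"
    using that by (simp add: gap_graph_def commons_def)
  show "hub_vertex c i l \<in> verts (gap_graph t z)" if "c < ncopies t z" "i \<le> t" "l < t"
    using that unfolding gap_graph_def graph.select_convs hubs_def by blast
  show "clique_vertex c \<tau> i \<in> verts (gap_graph t z)" if "c < ncopies t z" "\<tau> < ncliques t z" "i \<le> t"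
    using that unfolding gap_graph_def graph.select_convs gadget_clique_def by blast
qed

lemma gap_graph_vertsE:
  assumes "v \<in> verts (gap_graph t z)"
  obtains j where "v = common_vertex j" "j < z"
    | c i l where "v = hub_vertex c i l" "c < ncopies t z" "i \<le> t" "l < t"
    | c \<tau> i where "v = clique_vertex c \<tau> i" "c < ncopies t z" "\<tau> < ncliques t z" "i \<le> t"
  using assms by (auto simp: gap_graph_def commons_def hubs_def gadget_clique_def)

lemma card_hub_blocks: "card (\<Union>i\<le>t. hubs t c i) = Suc t * t"
proof -
  have "card (\<Union>i\<le>t. hubs t c i) = (\<Sum>i\<le>t. card (hubs t c i))"
    by (rule card_UN_disjoint) (auto simp: hubs_def)
  also have "\<dots> = (\<Sum>i\<le>t. t)" by (simp add: hubs_def card_image inj_on_def)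
  finally show ?thesis by simp
qed

text \<open>The sum counts the pairs of a hub and a clique vertex of \<open>\<tau>\<close> for which the color of the hub
blocks one of the \<open>t + 1\<close> reserved colors in \<open>R\<close>. Each hub is adjacent to only one vertex of the
clique, so this is the number of hubs that hit a set of at most \<open>t + 1\<close> colors.\<close>

lemma color_hubs:
  fixes L :: "nat \<Rightarrow> nat set"
  assumes cov: "fold_cover (gap_graph t z) (\<lambda>_. k) L H" and c: "c < ncopies t z" and "1 \<le> t"
    and R: "\<And>\<tau> i. \<tau> < ncliques t z \<Longrightarrow> i \<le> t \<Longrightarrow> R (clique_vertex c \<tau> i) \<subseteq> L (clique_vertex c \<tau> i) \<and> card (R (clique_vertex c \<tau> i)) = Suc t"
    and small: "ncliques t z * 2 ^ (Suc t * t) * Suc t ^ Suc t < k ^ Suc t"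
  obtains \<phi> where "\<And>i l. i \<le> t \<Longrightarrow> l < t \<Longrightarrow> \<phi> (hub_vertex c i l) \<in> L (hub_vertex c i l)"
    "\<And>\<tau>. \<tau> < ncliques t z \<Longrightarrow>
      (\<Sum>i\<le>t. card {x \<in> hubs t c i. \<exists>d\<in>R (clique_vertex c \<tau> i). {\<phi> x, d} \<in> edges H}) < Suc t"
proof -
  let ?G = "gap_graph t z" and ?W = "\<Union>i\<le>t. hubs t c i"
  define B where "B \<tau> w = {x \<in> L w. \<exists>i\<le>t. w \<in> hubs t c i \<and> (\<exists>d\<in>R (clique_vertex c \<tau> i). {x, d} \<in> edges H)}" for \<tau> w
  have B_eq: "B \<tau> w = {x \<in> L w. \<exists>d\<in>R (clique_vertex c \<tau> i). {x, d} \<in> edges H}" if "i \<le> t" "w \<in> hubs t c i" for \<tau> w i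
    using that by (auto simp: B_def hubs_def)
  have "\<exists>\<phi>\<in>Pi\<^sub>E ?W L. \<forall>\<tau>\<in>{..<ncliques t z}. card {w \<in> ?W. \<phi> w \<in> B \<tau> w} < Suc t"
  proof (rule choice_with_few_hits)
    show "finite ?W" by (simp add: hubs_def)
    show "Suc t \<le> card ?W" using \<open>1 \<le> t\<close> by (simp add: card_hub_blocks)
    show "card (L w) = k" if "w \<in> ?W" for w
      using cov that c by (auto simp: fold_cover_def hubs_def intro: gap_graph_vertsI)
    show "B \<tau> w \<subseteq> L w \<and> card (B \<tau> w) \<le> Suc t" if \<tau>: "\<tau> \<in> {..<ncliques t z}" and "w \<in> ?W" for \<tau> w
    proof -
      obtain i l where i: "i \<le> t" "l < t" "w = hub_vertex c i l" using \<open>w \<in> ?W\<close> by (auto simp: hubs_def)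
      have "card {x \<in> L w. \<exists>d\<in>R (clique_vertex c \<tau> i). {x, d} \<in> edges H} \<le> card (R (clique_vertex c \<tau> i))"
        using \<tau> i c R[of \<tau> i] by (intro card_neighbors_le[OF cov, of w "clique_vertex c \<tau> i"]) (auto intro: gap_graph_vertsI)
      then have "card (B \<tau> w) \<le> Suc t"
        using B_eq[of i w \<tau>] i R[of \<tau> i] \<tau> by (simp add: hubs_def)
      then show ?thesis by (auto simp: B_def)
    qed
    show "card {..<ncliques t z} * 2 ^ card ?W * Suc t ^ Suc t < k ^ Suc t"
      using small by (simp only: card_hub_blocks card_lessThan)
  qed simp_all
  then obtain \<phi> where \<phi>: "\<phi> \<in> Pi\<^sub>E ?W L" "\<And>\<tau>. \<tau> < ncliques t z \<Longrightarrow> card {w \<in> ?W. \<phi> w \<in> B \<tau> w} < Suc t"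
    by auto
  have mem: "\<phi> w \<in> L w" if "w \<in> ?W" for w using \<phi>(1) that by (rule PiE_mem)
  show ?thesis
  proof (rule that)
    show "\<phi> (hub_vertex c i l) \<in> L (hub_vertex c i l)" if "i \<le> t" "l < t" for i l
      using that by (intro mem) (auto simp: hubs_def)
    fix \<tau> assume \<tau>: "\<tau> < ncliques t z"
    have "(\<Sum>i\<le>t. card {x \<in> hubs t c i. \<exists>d\<in>R (clique_vertex c \<tau> i). {\<phi> x, d} \<in> edges H})
        = card (\<Union>i\<le>t. {x \<in> hubs t c i. \<exists>d\<in>R (clique_vertex c \<tau> i). {\<phi> x, d} \<in> edges H})"
      by (rule card_UN_disjoint[symmetric]) (auto simp: hubs_def)
    also have "(\<Union>i\<le>t. {x \<in> hubs t c i. \<exists>d\<in>R (clique_vertex c \<tau> i). {\<phi> x, d} \<in> edges H}) = {w \<in> ?W. \<phi> w \<in> B \<tau> w}"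
      using mem by (fastforce simp: B_def hubs_def)
    finally show "(\<Sum>i\<le>t. card {x \<in> hubs t c i. \<exists>d\<in>R (clique_vertex c \<tau> i). {\<phi> x, d} \<in> edges H}) < Suc t"
      using \<phi>(2)[OF \<tau>] by simp
  qed
qed

lemma color_clique:
  fixes L :: "nat \<Rightarrow> nat set"
  assumes cov: "fold_cover (gap_graph t z) f L H" and c: "c < ncopies t z" and \<tau>: "\<tau> < ncliques t z"
    and R: "\<And>i. i \<le> t \<Longrightarrow> R (clique_vertex c \<tau> i) \<subseteq> L (clique_vertex c \<tau> i) \<and> card (R (clique_vertex c \<tau> i)) = Suc t"
    and \<phi>: "\<And>i l. i \<le> t \<Longrightarrow> l < t \<Longrightarrow> \<phi> (hub_vertex c i l) \<in> L (hub_vertex c i l)"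
    and small: "(\<Sum>i\<le>t. card {x \<in> hubs t c i. \<exists>d\<in>R (clique_vertex c \<tau> i). {\<phi> x, d} \<in> edges H}) < Suc t"
  shows "\<exists>\<psi>. \<forall>i\<le>t. \<psi> (clique_vertex c \<tau> i) \<in> R (clique_vertex c \<tau> i) \<and>
      (\<forall>l<t. {\<phi> (hub_vertex c i l), \<psi> (clique_vertex c \<tau> i)} \<notin> edges H) \<and>
      (\<forall>i'\<le>t. {\<psi> (clique_vertex c \<tau> i), \<psi> (clique_vertex c \<tau> i')} \<notin> edges H)"
proof -
  let ?G = "gap_graph t z"
  define R' where "R' u = {d \<in> R u. \<forall>i\<le>t. u = clique_vertex c \<tau> i \<longrightarrow> (\<forall>x\<in>hubs t c i. {\<phi> x, d} \<notin> edges H)}" for u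
  have cardK: "card (gadget_clique t c \<tau>) = Suc t" by (simp add: gadget_clique_def card_image inj_on_def)
  have deficit: "Suc t - card (R' (clique_vertex c \<tau> i)) \<le> card {x \<in> hubs t c i. \<exists>d\<in>R (clique_vertex c \<tau> i). {\<phi> x, d} \<in> edges H}"
    if i: "i \<le> t" for i
  proof -
    let ?u = "clique_vertex c \<tau> i"
    let ?D = "{d \<in> R ?u. \<exists>x\<in>hubs t c i. {\<phi> x, d} \<in> edges H}"
    have u: "?u \<in> verts ?G" using c \<tau> i by (rule gap_graph_vertsI)
    have fin: "finite (R ?u)" using R[OF i] by (metis card.infinite nat.distinct(1))
    have "R' ?u = R ?u - ?D" using i by (auto simp: R'_def)
    then have "card (R' ?u) = Suc t - card ?D" using R[OF i] fin by (simp add: card_Diff_subset)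
    moreover have "card ?D \<le> card {x \<in> hubs t c i. \<exists>d\<in>R ?u. {\<phi> x, d} \<in> edges H}"
    proof (rule card_blocked_le[OF cov])
      show "hubs t c i \<subseteq> verts ?G" using c i by (auto simp: hubs_def intro: gap_graph_vertsI)
      show "\<And>x. x \<in> hubs t c i \<Longrightarrow> \<phi> x \<in> L x" using \<phi> i by (auto simp: hubs_def)
    qed (use R[OF i] u in \<open>auto simp: hubs_def\<close>)
    ultimately show ?thesis by linarith
  qed
  have "\<exists>\<psi>. (\<forall>v\<in>gadget_clique t c \<tau>. \<psi> v \<in> R' v) \<and> (\<forall>u\<in>gadget_clique t c \<tau>. \<forall>v\<in>gadget_clique t c \<tau>. {\<psi> u, \<psi> v} \<notin> edges H)"
  proof (rule small_deficit_transversal[OF cov])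
    show "finite (gadget_clique t c \<tau>)" by (simp add: gadget_clique_def)
    show "gadget_clique t c \<tau> \<subseteq> verts ?G" using c \<tau> by (auto simp: gadget_clique_def intro: gap_graph_vertsI)
    show "\<And>v. v \<in> gadget_clique t c \<tau> \<Longrightarrow> R' v \<subseteq> L v" using R by (auto simp: gadget_clique_def R'_def)
    have "(\<Sum>v\<in>gadget_clique t c \<tau>. card (gadget_clique t c \<tau>) - card (R' v)) = (\<Sum>i\<le>t. Suc t - card (R' (clique_vertex c \<tau> i)))"
      unfolding cardK unfolding gadget_clique_def by (subst sum.reindex) (auto simp: inj_on_def)
    also have "\<dots> \<le> (\<Sum>i\<le>t. card {x \<in> hubs t c i. \<exists>d\<in>R (clique_vertex c \<tau> i). {\<phi> x, d} \<in> edges H})"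
      using deficit by (intro sum_mono) simp
    also have "\<dots> < card (gadget_clique t c \<tau>)" using small by (simp add: cardK)
    finally show "(\<Sum>v\<in>gadget_clique t c \<tau>. card (gadget_clique t c \<tau>) - card (R' v)) < card (gadget_clique t c \<tau>)" .
  qed
  then obtain \<psi> where "(\<forall>v\<in>gadget_clique t c \<tau>. \<psi> v \<in> R' v) \<and>
      (\<forall>u\<in>gadget_clique t c \<tau>. \<forall>v\<in>gadget_clique t c \<tau>. {\<psi> u, \<psi> v} \<notin> edges H)" ..
  then have \<psi>: "\<And>i. i \<le> t \<Longrightarrow> \<psi> (clique_vertex c \<tau> i) \<in> R' (clique_vertex c \<tau> i)"
      "\<And>i i'. i \<le> t \<Longrightarrow> i' \<le> t \<Longrightarrow> {\<psi> (clique_vertex c \<tau> i), \<psi> (clique_vertex c \<tau> i')} \<notin> edges H"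
    by (auto simp: gadget_clique_def)
  then show ?thesis by (intro exI[of _ \<psi>]) (simp add: R'_def hubs_def)
qed

text \<open>The common vertices are colored arbitrarily, and every clique vertex reserves a set \<open>R\<close> of
\<open>t + 1\<close> colors not blocked by them. After that the copies do not interact, and within a copy the
cliques interact only through the hubs.\<close>

lemma DP_colorable_gap_graph:
  assumes t: "1 \<le> t" and small: "ncliques t z * 2 ^ (Suc t * t) * Suc t ^ Suc t < (z + Suc t) ^ Suc t"
  shows "DP_colorable (gap_graph t z) (\<lambda>_. z + Suc t)"
proof (rule DP_colorableI)
  fix L :: "nat \<Rightarrow> nat set" and H
  let ?G = "gap_graph t z" and ?T = "ncliques t z" and ?M = "ncopies t z"
  assume cov: "fold_cover ?G (\<lambda>_. z + Suc t) L H"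
  have cardL: "card (L v) = z + Suc t" if "v \<in> verts ?G" for v
    using cov that by (simp add: fold_cover_def)
  define \<zeta> where "\<zeta> v = (SOME x. x \<in> L v)" for v
  have \<zeta>: "\<zeta> (common_vertex j) \<in> L (common_vertex j)" if "j < z" for j
    unfolding \<zeta>_def some_in_eq using cardL[OF gap_graph_vertsI(1)[OF that]] by (metis add_Suc_right card.empty nat.distinct(1))
  define A where "A u = {d \<in> L u. \<forall>j<z. {\<zeta> (common_vertex j), d} \<notin> edges H}" for u
  have A: "Suc t \<le> card (A (clique_vertex c \<tau> i))" if "c < ?M" "\<tau> < ?T" "i \<le> t" for c \<tau> i
  proof -
    let ?u = "clique_vertex c \<tau> i"
    let ?D = "{d \<in> L ?u. \<exists>x\<in>commons z. {\<zeta> x, d} \<in> edges H}"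
    have u: "?u \<in> verts ?G" using that by (rule gap_graph_vertsI)
    have "card ?D \<le> card {x \<in> commons z. \<exists>d\<in>L ?u. {\<zeta> x, d} \<in> edges H}"
      by (rule card_blocked_le[OF cov]) (use u \<zeta> in \<open>auto simp: commons_def intro: gap_graph_vertsI\<close>)
    also have "\<dots> \<le> card (commons z)" by (rule card_mono) (auto simp: commons_def)
    also have "\<dots> = z" by (simp add: commons_def card_image inj_on_def)
    finally have "card ?D \<le> z" .
    moreover have "A ?u = L ?u - ?D" by (auto simp: A_def commons_def)
    then have "card (A ?u) = card (L ?u) - card ?D"
      using fold_cover_finite[OF cov u] by (simp add: card_Diff_subset)
    ultimately show ?thesis using cardL[OF u] by linarith
  qed
  define R where "R u = (SOME R. R \<subseteq> A u \<and> card R = Suc t)" for u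
  have R: "R (clique_vertex c \<tau> i) \<subseteq> A (clique_vertex c \<tau> i) \<and> card (R (clique_vertex c \<tau> i)) = Suc t"
    if u: "c < ?M" "\<tau> < ?T" "i \<le> t" for c \<tau> i
  proof -
    obtain Q where "Q \<subseteq> A (clique_vertex c \<tau> i)" "card Q = Suc t"
      using obtain_subset_with_card_n[OF A[OF u]] by metis
    then have "\<exists>Q. Q \<subseteq> A (clique_vertex c \<tau> i) \<and> card Q = Suc t" by blast
    then show ?thesis unfolding R_def by (rule someI_ex)
  qed
  have AL: "A u \<subseteq> L u" for u by (auto simp: A_def)
  define good where "good c \<phi> \<longleftrightarrow> (\<forall>i\<le>t. \<forall>l<t. \<phi> (hub_vertex c i l) \<in> L (hub_vertex c i l)) \<and>
      (\<forall>\<tau><?T. (\<Sum>i\<le>t. card {x \<in> hubs t c i. \<exists>d\<in>R (clique_vertex c \<tau> i). {\<phi> x, d} \<in> edges H}) < Suc t)" for c \<phi>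
  have "\<exists>\<phi>. good c \<phi>" if c: "c < ?M" for c
  proof (rule color_hubs[OF cov c t _ small, of R])
    show "R (clique_vertex c \<tau> i) \<subseteq> L (clique_vertex c \<tau> i) \<and> card (R (clique_vertex c \<tau> i)) = Suc t" if "\<tau> < ?T" "i \<le> t" for \<tau> i
      using R[OF c that] AL by blast
    show ?thesis if "\<And>i l. i \<le> t \<Longrightarrow> l < t \<Longrightarrow> \<phi> (hub_vertex c i l) \<in> L (hub_vertex c i l)"
      "\<And>\<tau>. \<tau> < ?T \<Longrightarrow>
        (\<Sum>i\<le>t. card {x \<in> hubs t c i. \<exists>d\<in>R (clique_vertex c \<tau> i). {\<phi> x, d} \<in> edges H}) < Suc t" for \<phi>
      using that by (intro exI[of _ \<phi>]) (simp add: good_def)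
  qed
  then obtain \<phi> where "\<And>c. c < ?M \<Longrightarrow> good c (\<phi> c)" by metis
  then have \<phi>: "\<And>c i l. c < ?M \<Longrightarrow> i \<le> t \<Longrightarrow> l < t \<Longrightarrow> \<phi> c (hub_vertex c i l) \<in> L (hub_vertex c i l)"
      "\<And>c \<tau>. c < ?M \<Longrightarrow> \<tau> < ?T \<Longrightarrow>
        (\<Sum>i\<le>t. card {x \<in> hubs t c i. \<exists>d\<in>R (clique_vertex c \<tau> i). {\<phi> c x, d} \<in> edges H}) < Suc t"
    by (simp_all add: good_def)
  define fits where "fits c \<tau> \<psi> \<longleftrightarrow> (\<forall>i\<le>t. \<psi> (clique_vertex c \<tau> i) \<in> R (clique_vertex c \<tau> i) \<and>
      (\<forall>l<t. {\<phi> c (hub_vertex c i l), \<psi> (clique_vertex c \<tau> i)} \<notin> edges H) \<and>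
      (\<forall>i'\<le>t. {\<psi> (clique_vertex c \<tau> i), \<psi> (clique_vertex c \<tau> i')} \<notin> edges H))" for c \<tau> and \<psi> :: "nat \<Rightarrow> nat"
  have "\<exists>\<psi>. fits c \<tau> \<psi>" if c: "c < ?M" and \<tau>: "\<tau> < ?T" for c \<tau>
    unfolding fits_def
  proof (rule color_clique[OF cov c \<tau>])
    show "R (clique_vertex c \<tau> i) \<subseteq> L (clique_vertex c \<tau> i) \<and> card (R (clique_vertex c \<tau> i)) = Suc t" if "i \<le> t" for i
      using R[OF c \<tau> that] AL by blast
    show "\<phi> c (hub_vertex c i l) \<in> L (hub_vertex c i l)" if "i \<le> t" "l < t" for i l
      by (rule \<phi>(1)[OF c that])
    show "(\<Sum>i\<le>t. card {x \<in> hubs t c i. \<exists>d\<in>R (clique_vertex c \<tau> i). {\<phi> c x, d} \<in> edges H}) < Suc t"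
      by (rule \<phi>(2)[OF c \<tau>])
  qed
  then obtain \<psi> where "\<And>c \<tau>. c < ?M \<Longrightarrow> \<tau> < ?T \<Longrightarrow> fits c \<tau> (\<psi> c \<tau>)" by metis
  then have \<psi>: "\<And>c \<tau> i. c < ?M \<Longrightarrow> \<tau> < ?T \<Longrightarrow> i \<le> t \<Longrightarrow>
      \<psi> c \<tau> (clique_vertex c \<tau> i) \<in> R (clique_vertex c \<tau> i) \<and>
      (\<forall>l<t. {\<phi> c (hub_vertex c i l), \<psi> c \<tau> (clique_vertex c \<tau> i)} \<notin> edges H) \<and>
      (\<forall>i'\<le>t. {\<psi> c \<tau> (clique_vertex c \<tau> i), \<psi> c \<tau> (clique_vertex c \<tau> i')} \<notin> edges H)"
    by (simp add: fits_def)
  define \<Phi> where "\<Phi> v = (if v \<in> commons z then \<zeta> v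
      else if v \<in> (\<Union>i\<le>t. hubs t (copy_of v) i) then \<phi> (copy_of v) v
      else \<psi> (copy_of v) (clique_of v) v)" for v
  have \<Phi>Z: "\<Phi> (common_vertex j) = \<zeta> (common_vertex j)" if "j < z" for j using that by (simp add: \<Phi>_def commons_def)
  have \<Phi>W: "\<Phi> (hub_vertex c i l) = \<phi> c (hub_vertex c i l)" if "i \<le> t" "l < t" for c i l
    using that by (auto simp: \<Phi>_def commons_def hubs_def)
  have \<Phi>U: "\<Phi> (clique_vertex c \<tau> i) = \<psi> c \<tau> (clique_vertex c \<tau> i)" for c \<tau> i
    by (auto simp: \<Phi>_def commons_def hubs_def)
  have UA: "\<Phi> (clique_vertex c \<tau> i) \<in> A (clique_vertex c \<tau> i)" if "c < ?M" "\<tau> < ?T" "i \<le> t" for c \<tau> i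
    using \<psi>[OF that] R[OF that] by (auto simp: \<Phi>U)
  have "\<Phi> v \<in> L v" if "v \<in> verts ?G" for v
    using that
  proof (cases rule: gap_graph_vertsE)
    case (1 j) then show ?thesis using \<zeta> \<Phi>Z by simp
  next
    case (2 c i l) then show ?thesis using \<phi>(1) \<Phi>W by simp
  next
    case (3 c \<tau> i) then show ?thesis using UA AL by blast
  qed
  moreover have "{\<Phi> u, \<Phi> v} \<notin> edges H" if "{u, v} \<in> edges ?G" for u v
    using that
  proof (cases rule: gap_graph_edgeE)
    case (zu j c \<tau> i)
    then have "{\<Phi> (common_vertex j), \<Phi> (clique_vertex c \<tau> i)} \<notin> edges H"
      using UA[of c \<tau> i] \<Phi>Z[of j] by (simp add: A_def)
    then show ?thesis using zu(1) by (auto simp: doubleton_eq_iff insert_commute)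
  next
    case (wu c \<tau> i l)
    then have "{\<Phi> (hub_vertex c i l), \<Phi> (clique_vertex c \<tau> i)} \<notin> edges H" using \<psi>[of c \<tau> i] by (simp add: \<Phi>W \<Phi>U)
    then show ?thesis using wu(1) by (auto simp: doubleton_eq_iff insert_commute)
  next
    case (uu c \<tau> i i')
    then have "{\<Phi> (clique_vertex c \<tau> i), \<Phi> (clique_vertex c \<tau> i')} \<notin> edges H" using \<psi>[of c \<tau> i] by (simp add: \<Phi>U)
    then show ?thesis using uu(1) by (auto simp: doubleton_eq_iff insert_commute)
  qed
  ultimately show "\<exists>\<phi>. (\<forall>v\<in>verts ?G. \<phi> v \<in> L v) \<and>
      (\<forall>u\<in>verts ?G. \<forall>v\<in>verts ?G. {u, v} \<in> edges ?G \<longrightarrow> {\<phi> u, \<phi> v} \<notin> edges H)"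
    by (intro exI[of _ \<Phi>]) simp
qed

text \<open>Up to factors that depend on \<open>t\<close> only, the left side is \<open>z ^ t\<close> and the right side is
\<open>z ^ (t + 1)\<close>; the value of \<open>z\<close> is the product of these factors.\<close>

lemma enough_colors:
  assumes "z = Suc t * 2 ^ t * 2 ^ (Suc t * t) * Suc t ^ Suc t"
  shows "ncliques t z * 2 ^ (Suc t * t) * Suc t ^ Suc t < (z + Suc t) ^ Suc t"
proof -
  define k where "k = z + Suc t"
  have "tokens t z ^ t \<le> (2 * k) ^ t" by (intro power_mono) (auto simp: tokens_def k_def)
  then have "ncliques t z * 2 ^ (Suc t * t) * Suc t ^ Suc t
      \<le> Suc t * (2 * k) ^ t * 2 ^ (Suc t * t) * Suc t ^ Suc t"
    unfolding ncliques_def by (intro mult_right_mono mult_left_mono) auto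
  also have "\<dots> = Suc t * 2 ^ t * 2 ^ (Suc t * t) * Suc t ^ Suc t * k ^ t"
    by (simp only: power_mult_distrib ac_simps)
  also have "\<dots> = z * k ^ t" by (simp only: assms)
  also have "\<dots> < k * k ^ t" by (intro mult_strict_right_mono) (auto simp: k_def)
  finally show ?thesis by (simp add: k_def)
qed

section \<open>The gap\<close>

theorem mainTheorem1:
  fixes t :: nat
  assumes "t \<ge> 1"
  shows "\<exists>G :: nat graph. simple_graph G \<and>
           int (chi_DPP G) - int (chi_DP G) \<ge> int t \<and>
           int (chi_P G) - int (chi_DP G) \<ge> int t"
proof -
  define z where "z = Suc t * 2 ^ t * 2 ^ (Suc t * t) * Suc t ^ Suc t"
  let ?G = "gap_graph t z"
  have simple: "simple_graph ?G" by (rule simple_gap_graph)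
  then have fin: "finite (verts ?G)" by (simp add: simple_graph_def)
  have DP: "chi_DP ?G \<le> z + Suc t"
    unfolding chi_DP_def by (rule Least_le) (rule DP_colorable_gap_graph[OF assms enough_colors[OF z_def]])
  have not_P: "\<not> paintable ?G (\<lambda>_. k)" if "k \<le> tokens t z" for k
    by (rule lister_wins_not_paintable[OF fin]) (rule lister_wins_mono[OF lister_wins_gap_graph], use that in auto)
  have ex: "DP_paintable ?G (\<lambda>_. card (verts ?G))" by (rule DP_paintable_card_verts[OF fin])
  have "DP_paintable ?G (\<lambda>_. chi_DPP ?G)"
    unfolding chi_DPP_def by (rule LeastI) (rule ex)
  then have "paintable ?G (\<lambda>_. chi_DPP ?G)" by (rule DP_paintable_imp_paintable[OF simple])
  then have "tokens t z < chi_DPP ?G" using not_P not_le by blast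
  moreover have "paintable ?G (\<lambda>_. chi_P ?G)"
    unfolding chi_P_def by (rule LeastI) (rule DP_paintable_imp_paintable[OF simple ex])
  then have "tokens t z < chi_P ?G" using not_P not_le by blast
  ultimately have "int (chi_DPP ?G) - int (chi_DP ?G) \<ge> int t" "int (chi_P ?G) - int (chi_DP ?G) \<ge> int t"
    using DP by (simp_all add: tokens_def)
  with simple show ?thesis by blast
qed

end
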